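(* Let $\mathcal C=\{x\in\mathbb T:b(x)=0\}$ and $\mathcal M=\{x\in\mathcal C: b'(x)<0\}$. As $\epsilon\to0$, $I_\epsilon$ $\Gamma$-converges to the functional $J^{(0)}:\mathcal P(\mathbb T)\to[0,+\infty]$ given by $$J^{(0)}(\mu)=\begin{cases}\displaystyle\sum_{z\in\mathcal C}w(z)\,\max\{b'(z),0\} &\text{if } \mu=\sum_{z\in\mathcal C}w(z)\,\delta_z\text{ for some probability measure } w\text{ on }\mathcal C,\\ +\infty&\text{otherwise.}\end{cases}$$ The $0$-level set of $J^{(0)}$ consists of all convex combinations of Dirac measures supported on the elements of $\mathcal M$.
   Context: $\mathbb T=[0,1)$ is the one-dimensional torus of length $1$. Standing assumptions: $a,b:\mathbb T\to\mathbb R$ are of class $C^2(\mathbb T)$; $a(x)\ge c_0>0$ for all $x$; $b$ vanishes at exactly finitely many points $x_1,\dots,x_{2N}$ ($N\ge1$), and $b'(x_j)\ne0$ for each $j$. Put $B=\int_{\mathbb T} b(x)/a(x)\,dx$; it is assumed that $B\ge0$. For $\epsilon>0$, $L_\epsilon f=b f'+\epsilon\, a f''$, $f\in C^2(\mathbb T)$, is the generator of the diffusion $dX_\epsilon=b(X_\epsilon)dt+\sqrt{2\epsilon a(X_\epsilon)}\,dW_t$ on $\mathbb T$. $\mathcal P(\mathbb T)$ is the set of Borel probability measures on $\mathbb T$ with the weak topology. The level-two (Donsker–Varadhan) rate functional is $$I_\epsilon(\mu)=\sup_{u}\;-\int_{\mathbb T}\frac{L_\epsilon u}{u}\,d\mu,$$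 the supremum being over all strictly positive $u\in C^2(\mathbb T)$ (the domain of the generator). $\delta_z$ is the Dirac measure at $z$. A family of functionals $F_\epsilon:\mathcal P(\mathbb T)\to[0,+\infty]$ $\Gamma$-converges to $F$ as $\epsilon\to0$ if for every $\mu$: (i) $\liminf_{\epsilon\to0}F_\epsilon(\mu_\epsilon)\ge F(\mu)$ for every $\mu_\epsilon\to\mu$ weakly; (ii) there exists $\mu_\epsilon\to\mu$ weakly with $\limsup_{\epsilon\to0}F_\epsilon(\mu_\epsilon)\le F(\mu)$. *)

theory Defs
  imports "HOL-Probability.Probability"
begin

text \<open>
  The torus is the set \<open>[0,1)\<close>, and a function on it is a 1-periodic function on the whole
  real line, so that continuity and differentiability on the torus (in particular at the point
  0, which is glued to 1) are the usual notions on the line.  The Borel sets of the torus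
  are exactly the Borel subsets of \<open>[0,1)\<close>.
\<close>

definition torus :: "real measure" where
  "torus = restrict_space borel {0..<1}"

definition C0_torus :: "(real \<Rightarrow> real) set" where
  "C0_torus = {f. (\<forall>x. f (x + 1) = f x) \<and> continuous_on UNIV f}"

definition C2_torus :: "(real \<Rightarrow> real) set" where
  "C2_torus = {f. (\<forall>x. f (x + 1) = f x)
     \<and> (\<forall>x. f differentiable at x)
     \<and> (\<forall>x. deriv f differentiable at x)
     \<and> continuous_on UNIV (deriv (deriv f))}"

text \<open>
  The weak topology is the coarsest one making \<open>\<mu> \<mapsto> \<integral>f d\<mu>\<close> continuous for every continuous
  \<open>f\<close> on the torus.
\<close>

definition weak_topology :: "real measure topology" where
  "weak_topology = topology_generated_by
     {{\<mu> \<in> space (prob_algebra torus). (\<integral>x. f x \<partial>\<mu>) \<in> U} | f U. f \<in> C0_torus \<and> open U}"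

lemma topspace_weak_topology [simp]: "topspace weak_topology = space (prob_algebra torus)"
proof -
  have "(\<lambda>x. 0) \<in> C0_torus"
    by (simp add: C0_torus_def)
  then show ?thesis
    unfolding weak_topology_def topology_generated_by_topspace
    by (auto intro!: exI[of _ "\<lambda>x::real. 0::real"] exI[of _ "UNIV :: real set"])
qed

lemma limitin_weak_topology:
  assumes m: "\<forall>\<^sub>F i in G. m i \<in> space (prob_algebra torus)"
  shows "limitin weak_topology m \<mu> G \<longleftrightarrow>
    \<mu> \<in> space (prob_algebra torus) \<and>
    (\<forall>f\<in>C0_torus. ((\<lambda>i. \<integral>x. f x \<partial>m i) \<longlongrightarrow> (\<integral>x. f x \<partial>\<mu>)) G)"
proof (intro iffI conjI ballI)
  assume L: "limitin weak_topology m \<mu> G"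
  then show P: "\<mu> \<in> space (prob_algebra torus)"
    using limitin_topspace by fastforce
  fix f assume f: "f \<in> C0_torus"
  show "((\<lambda>i. \<integral>x. f x \<partial>m i) \<longlongrightarrow> (\<integral>x. f x \<partial>\<mu>)) G"
  proof (rule topological_tendstoI)
    fix U :: "real set" assume U: "open U" "(\<integral>x. f x \<partial>\<mu>) \<in> U"
    let ?V = "{\<mu> \<in> space (prob_algebra torus). (\<integral>x. f x \<partial>\<mu>) \<in> U}"
    have "openin weak_topology ?V"
      unfolding weak_topology_def by (rule topology_generated_by_Basis) (use f U in blast)
    with L U P have "\<forall>\<^sub>F i in G. m i \<in> ?V"
      unfolding limitin_def by blast
    then show "\<forall>\<^sub>F i in G. (\<integral>x. f x \<partial>m i) \<in> U"
      by (rule eventually_mono) simp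
  qed
next
  assume R: "\<mu> \<in> space (prob_algebra torus) \<and>
    (\<forall>f\<in>C0_torus. ((\<lambda>i. \<integral>x. f x \<partial>m i) \<longlongrightarrow> (\<integral>x. f x \<partial>\<mu>)) G)"
  have "\<mu> \<in> V \<longrightarrow> (\<forall>\<^sub>F i in G. m i \<in> V)" if "openin weak_topology V" for V
    using that unfolding weak_topology_def openin_topology_generated_by_iff
  proof (induction rule: generate_topology_on.induct)
    case (Int a b)
    then show ?case by (auto intro: eventually_conj)
  next
    case (UN K)
    show ?case
    proof
      assume "\<mu> \<in> \<Union>K"
      then obtain k where "k \<in> K" "\<mu> \<in> k" by blast
      with UN.IH show "\<forall>\<^sub>F i in G. m i \<in> \<Union>K"
        by (blast intro: eventually_mono)
    qed
  next
    case (Basis s)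
    then obtain f U where s: "s = {\<mu> \<in> space (prob_algebra torus). (\<integral>x. f x \<partial>\<mu>) \<in> U}"
      and f: "f \<in> C0_torus" and U: "open U" by blast
    show ?case
    proof
      assume "\<mu> \<in> s"
      then have "\<forall>\<^sub>F i in G. (\<integral>x. f x \<partial>m i) \<in> U"
        using R f U s topological_tendstoD by fastforce
      with m show "\<forall>\<^sub>F i in G. m i \<in> s"
        unfolding s by eventually_elim simp
    qed
  qed simp
  with R show "limitin weak_topology m \<mu> G"
    by (simp add: limitin_def)
qed

definition generator :: "(real \<Rightarrow> real) \<Rightarrow> (real \<Rightarrow> real) \<Rightarrow> real \<Rightarrow> (real \<Rightarrow> real) \<Rightarrow> real \<Rightarrow> real" where
  "generator a b \<epsilon> f x = b x * deriv f x + \<epsilon> * a x * deriv (deriv f) x"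

definition rate :: "(real \<Rightarrow> real) \<Rightarrow> (real \<Rightarrow> real) \<Rightarrow> real \<Rightarrow> real measure \<Rightarrow> ereal" where
  "rate a b \<epsilon> \<mu> =
     (SUP u \<in> {u \<in> C2_torus. \<forall>x. u x > 0}. ereal (- (\<integral>x. generator a b \<epsilon> u x / u x \<partial>\<mu>)))"

definition gamma_converges :: "'p topology \<Rightarrow> (real \<Rightarrow> 'p \<Rightarrow> ereal) \<Rightarrow> ('p \<Rightarrow> ereal) \<Rightarrow> bool" where
  "gamma_converges X F F0 \<longleftrightarrow> (\<forall>\<mu> \<in> topspace X.
     (\<forall>m. (\<forall>\<epsilon>>0. m \<epsilon> \<in> topspace X) \<and> limitin X m \<mu> (at_right 0)
        \<longrightarrow> Liminf (at_right 0) (\<lambda>\<epsilon>. F \<epsilon> (m \<epsilon>)) \<ge> F0 \<mu>) \<and>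
     (\<exists>m. (\<forall>\<epsilon>>0. m \<epsilon> \<in> topspace X) \<and> limitin X m \<mu> (at_right 0)
        \<and> Limsup (at_right 0) (\<lambda>\<epsilon>. F \<epsilon> (m \<epsilon>)) \<le> F0 \<mu>))"

definition crit :: "(real \<Rightarrow> real) \<Rightarrow> real set" where
  "crit b = {x \<in> {0..<1}. b x = 0}"

definition stable_crit :: "(real \<Rightarrow> real) \<Rightarrow> real set" where
  "stable_crit b = {x \<in> crit b. deriv b x < 0}"

text \<open>
  A probability measure on a finite set \<open>S\<close> of points is a \<open>pmf\<close> \<open>w\<close> with \<open>set_pmf w \<subseteq> S\<close>;
  \<open>dirac_combination S w\<close> is the measure \<open>\<Sum>z\<in>S. w(z) \<delta>\<^sub>z\<close> on the torus.
\<close>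

definition dirac_combination :: "real set \<Rightarrow> real pmf \<Rightarrow> real measure" where
  "dirac_combination S w = measure_of (space torus) (sets torus)
     (\<lambda>A. \<Sum>z\<in>S. ennreal (pmf w z) * emeasure (return torus z) A)"

text \<open>The weights \<open>w\<close> are determined by the measure, see \<open>J0_dirac_combination\<close> below.\<close>

definition J0 :: "(real \<Rightarrow> real) \<Rightarrow> real measure \<Rightarrow> ereal" where
  "J0 b \<mu> =
    (if \<exists>w. set_pmf w \<subseteq> crit b \<and> \<mu> = dirac_combination (crit b) w
     then let w = (THE w. set_pmf w \<subseteq> crit b \<and> \<mu> = dirac_combination (crit b) w)
          in ereal (\<Sum>z\<in>crit b. pmf w z * max (deriv b z) 0)
     else \<infinity>)"

lemma sets_dirac_combination [simp]: "sets (dirac_combination S w) = sets torus"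
  unfolding dirac_combination_def by (simp add: sets.space_closed sets.sigma_sets_eq)

lemma emeasure_dirac_combination:
  assumes "A \<in> sets torus"
  shows "emeasure (dirac_combination S w) A
    = (\<Sum>z\<in>S. ennreal (pmf w z) * emeasure (return torus z) A)"
  unfolding dirac_combination_def
proof (rule emeasure_measure_of_sigma)
  show "countably_additive (sets torus)
    (\<lambda>A. \<Sum>z\<in>S. ennreal (pmf w z) * emeasure (return torus z) A)"
  proof (rule countably_additiveI)
    fix A :: "nat \<Rightarrow> real set"
    assume A: "range A \<subseteq> sets torus" "disjoint_family A"
    have "(\<Sum>i. \<Sum>z\<in>S. ennreal (pmf w z) * emeasure (return torus z) (A i))
      = (\<Sum>z\<in>S. \<Sum>i. ennreal (pmf w z) * emeasure (return torus z) (A i))"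
      by (rule suminf_sum) simp
    also have "\<dots> = (\<Sum>z\<in>S. ennreal (pmf w z) * emeasure (return torus z) (\<Union>i. A i))"
      using A by (intro sum.cong refl) (simp only: sets_return ennreal_suminf_cmult suminf_emeasure)
    finally show "(\<Sum>i. \<Sum>z\<in>S. ennreal (pmf w z) * emeasure (return torus z) (A i))
      = (\<Sum>z\<in>S. ennreal (pmf w z) * emeasure (return torus z) (\<Union>i. A i))" .
  qed
qed (use assms in \<open>auto simp: sets.sigma_algebra_axioms positive_def\<close>)

lemma dirac_combination_in_prob_algebra:
  assumes "finite S" "S \<subseteq> {0..<1}" "set_pmf w \<subseteq> S"
  shows "dirac_combination S w \<in> space (prob_algebra torus)"
proof -
  have sp: "space torus = {0..<1}"
    by (simp add: torus_def space_restrict_space)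
  have "emeasure (dirac_combination S w) (space torus) = (\<Sum>z\<in>S. ennreal (pmf w z))"
    unfolding emeasure_dirac_combination[OF sets.top]
  proof (intro sum.cong refl)
    fix z assume "z \<in> S"
    then have "z \<in> space torus" using assms(2) sp by auto
    then show "ennreal (pmf w z) * emeasure (return torus z) (space torus) = ennreal (pmf w z)"
      by simp
  qed
  also have "\<dots> = 1"
    using assms by (simp add: sum_ennreal sum_pmf_eq_1)
  finally have "prob_space (dirac_combination S w)"
    by (intro prob_spaceI) (simp add: sets_eq_imp_space_eq[OF sets_dirac_combination])
  then show ?thesis
    by (simp add: space_prob_algebra)
qed

lemma dirac_combination_inject:
  assumes fin: "finite S" and S: "S \<subseteq> {0..<1}"
    and w: "set_pmf w \<subseteq> S" and v: "set_pmf v \<subseteq> S"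
    and eq: "dirac_combination S w = dirac_combination S v"
  shows "w = v"
proof -
  have *: "emeasure (dirac_combination S p) {y} = ennreal (pmf p y)" if "y \<in> S" for p y
  proof -
    have "{y} \<in> sets torus"
      using that S by (auto simp: torus_def sets_restrict_space_iff)
    then have "emeasure (dirac_combination S p) {y}
      = (\<Sum>z\<in>S. if z = y then ennreal (pmf p y) else 0)"
      by (auto simp: emeasure_dirac_combination intro!: sum.cong)
    then show ?thesis
      using that fin by simp
  qed
  show ?thesis
  proof (rule pmf_eqI)
    fix y
    show "pmf w y = pmf v y"
    proof (cases "y \<in> S")
      case True
      then show ?thesis using *[of y w] *[of y v] eq by simp
    next
      case False
      then have "y \<notin> set_pmf w" "y \<notin> set_pmf v" using w v by auto
      then show ?thesis by (simp add: set_pmf_iff)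
    qed
  qed
qed

lemma J0_dirac_combination:
  assumes "finite (crit b)" "set_pmf w \<subseteq> crit b"
  shows "J0 b (dirac_combination (crit b) w) = ereal (\<Sum>z\<in>crit b. pmf w z * max (deriv b z) 0)"
proof -
  have "crit b \<subseteq> {0..<1}" by (auto simp: crit_def)
  then have "(THE v. set_pmf v \<subseteq> crit b \<and>
      dirac_combination (crit b) w = dirac_combination (crit b) v) = w"
    using assms by (intro the_equality) (auto dest: dirac_combination_inject)
  then show ?thesis
    using assms(2) by (auto simp: J0_def Let_def)
qed

end

theory Submission
  imports Defs
begin

text \<open>
  Write a positive test function as \<open>u = exp H\<close> and put \<open>G = H'\<close>.  Then
  \<open>L\<^sub>\<epsilon> u / u = b G + \<epsilon> a (G' + G\<^sup>2)\<close>, so the rate is a supremum over periodic \<open>C\<^sup>1\<close> fields \<open>G\<close>,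
  and the only global constraint is that \<open>G\<close> has mean zero.

  \<^emph>\<open>Lower bound.\<close>  For a fixed field the rate at \<open>\<mu>\<^sub>\<epsilon> \<rightarrow> \<mu>\<close> is asymptotically at least
  \<open>- \<integral> b G d\<mu>\<close>.  There is a mean-zero field with \<open>b G < 0\<close> off the zeros of \<open>b\<close>
  (\<open>exists_descent_direction\<close>); multiplying it by large constants makes the lower limit infinite
  unless \<open>\<mu>\<close> lives on the zeros (\<open>Liminf_rate_infinite\<close>).  On the zeros the scale \<open>G / \<epsilon>\<close> is the
  right one: \<open>L\<^sub>\<epsilon> u / u = (b G + a G\<^sup>2) / \<epsilon> + a G'\<close>, and if \<open>G\<close> lies between \<open>0\<close> and \<open>- b / a\<close>
  the first term is at most 0, which leaves \<open>- \<integral> a G' d\<mu>\<close>.  Where \<open>G\<close> is tangent to \<open>- b / a\<close> at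
  an unstable zero, \<open>- a G'\<close> equals \<open>b'\<close> there; where it is flat at a stable zero it contributes
  nothing.  The point is to find such a \<open>G\<close> of mean zero (\<open>exists_reversing_field\<close>).

  \<^emph>\<open>Upper bound.\<close>  The rate is convex, so it is enough to approximate the Dirac measure at one
  zero \<open>z\<close>.  Let \<open>S' = b / a\<close> and \<open>S z = 0\<close>.  Near a stable zero the density proportional to
  \<open>exp (S / \<epsilon>) / a\<close> is stationary; cut off by \<open>q\<^sup>2\<close>, it costs at most the energy of the cut-off,
  \<open>\<epsilon> \<integral> exp (S / \<epsilon>) q'\<^sup>2\<close> divided by the normalising constant, by completing a square
  (\<open>weighted_energy_lower_bound\<close>).  Near an unstable zero the density is built from \<open>- S\<close> instead;
  the substitution \<open>G = \<Gamma> - b / (\<epsilon> a)\<close> reverses the drift and produces the extra term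
  \<open>a (b / a)'\<close>, which is \<open>b'\<close> at the zero.  The densities concentrate at \<open>z\<close> and the energy term
  vanishes because the normalising constant is at least of order \<open>sqrt \<epsilon>\<close> (\<open>peak_estimates\<close>).
\<close>

section \<open>Continuously differentiable functions on the torus\<close>

text \<open>
  The elements of mean zero are exactly the logarithmic derivatives \<open>u' / u\<close> of the positive
  functions \<open>u\<close> in \<open>C2_torus\<close>.
\<close>

definition C1_torus :: "(real \<Rightarrow> real) set" where
  "C1_torus = {f. (\<forall>x. f (x + 1) = f x)
     \<and> (\<forall>x. f differentiable at x) \<and> continuous_on UNIV (deriv f)}"

lemma C1_torusI:
  assumes "\<And>x. f (x + 1) = f x" "\<And>x. (f has_real_derivative f' x) (at x)"
    "continuous_on UNIV f'"
  shows "f \<in> C1_torus"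
proof -
  have "deriv f = f'" using assms(2) by (auto intro: DERIV_imp_deriv)
  then show ?thesis
    using assms by (auto simp: C1_torus_def real_differentiable_def)
qed

lemma C1_torus_has_derivative:
  "f \<in> C1_torus \<Longrightarrow> (f has_real_derivative deriv f x) (at x)"
  by (simp add: C1_torus_def DERIV_deriv_iff_real_differentiable)

lemma C1_torus_subset_C0_torus: "C1_torus \<subseteq> C0_torus"
  unfolding C1_torus_def C0_torus_def
  by (auto intro!: differentiable_imp_continuous_on simp: differentiable_on_def)

lemma deriv_C1_torus:
  assumes "f \<in> C1_torus"
  shows "deriv f \<in> C0_torus"
proof -
  have "deriv f (x + 1) = deriv f x" for x
  proof -
    have "((\<lambda>x. f (x + 1)) has_real_derivative deriv f (x + 1)) (at x)"
      using C1_torus_has_derivative[OF assms, of "x + 1"] by (simp add: DERIV_shift)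
    moreover have "(\<lambda>x. f (x + 1)) = f" using assms by (auto simp: C1_torus_def)
    ultimately show ?thesis
      using C1_torus_has_derivative[OF assms, of x] DERIV_unique by metis
  qed
  then show ?thesis using assms by (simp add: C0_torus_def C1_torus_def)
qed

lemma C2_torus_subset_C1_torus: "C2_torus \<subseteq> C1_torus"
  unfolding C2_torus_def C1_torus_def
  by (auto intro!: differentiable_imp_continuous_on simp: differentiable_on_def)

lemma deriv_C2_torus:
  assumes "f \<in> C2_torus"
  shows "deriv f \<in> C1_torus"
proof -
  have "deriv f \<in> C0_torus" using assms C2_torus_subset_C1_torus deriv_C1_torus by blast
  then show ?thesis using assms by (auto simp: C0_torus_def C1_torus_def C2_torus_def)
qed

lemma C2_torusI:
  assumes "f \<in> C1_torus" "deriv f \<in> C1_torus"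
  shows "f \<in> C2_torus"
  using assms by (auto simp: C1_torus_def C2_torus_def)

lemma C0_torus_const [intro!]: "(\<lambda>x. c) \<in> C0_torus"
  and C0_torus_add [intro!]: "f \<in> C0_torus \<Longrightarrow> g \<in> C0_torus \<Longrightarrow> (\<lambda>x. f x + g x) \<in> C0_torus"
  and C0_torus_diff [intro!]: "f \<in> C0_torus \<Longrightarrow> g \<in> C0_torus \<Longrightarrow> (\<lambda>x. f x - g x) \<in> C0_torus"
  and C0_torus_mult [intro!]: "f \<in> C0_torus \<Longrightarrow> g \<in> C0_torus \<Longrightarrow> (\<lambda>x. f x * g x) \<in> C0_torus"
  and C0_torus_minus [intro!]: "f \<in> C0_torus \<Longrightarrow> (\<lambda>x. - f x) \<in> C0_torus"
  and C0_torus_power [intro!]: "f \<in> C0_torus \<Longrightarrow> (\<lambda>x. f x ^ n) \<in> C0_torus"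
  and C0_torus_max [intro!]: "f \<in> C0_torus \<Longrightarrow> g \<in> C0_torus \<Longrightarrow> (\<lambda>x. max (f x) (g x)) \<in> C0_torus"
  and C0_torus_divide [intro]:
    "f \<in> C0_torus \<Longrightarrow> g \<in> C0_torus \<Longrightarrow> (\<And>x. g x \<noteq> 0) \<Longrightarrow> (\<lambda>x. f x / g x) \<in> C0_torus"
  by (auto simp: C0_torus_def intro!: continuous_intros)

lemma C1_torus_const [intro!]: "(\<lambda>x. c) \<in> C1_torus"
  by (rule C1_torusI[where f' = "\<lambda>_. 0"]) auto

context
  fixes f g :: "real \<Rightarrow> real"
  assumes f: "f \<in> C1_torus" and g: "g \<in> C1_torus"
begin

private lemma facts:
  "f (x + 1) = f x" "g (x + 1) = g x"
  "(f has_real_derivative deriv f x) (at x)" "(g has_real_derivative deriv g x) (at x)"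
  "continuous_on UNIV f" "continuous_on UNIV g"
  "continuous_on UNIV (deriv f)" "continuous_on UNIV (deriv g)"
  using f g C1_torus_subset_C0_torus
  by (auto simp: C0_torus_def C1_torus_def C1_torus_has_derivative)

lemma C1_torus_add: "(\<lambda>x. f x + g x) \<in> C1_torus"
  by (rule C1_torusI[where f' = "\<lambda>x. deriv f x + deriv g x"])
    (auto intro!: derivative_eq_intros continuous_intros facts simp: facts(1,2))

lemma C1_torus_mult: "(\<lambda>x. f x * g x) \<in> C1_torus"
  by (rule C1_torusI[where f' = "\<lambda>x. deriv f x * g x + deriv g x * f x"])
    (auto intro!: derivative_eq_intros continuous_intros facts simp: facts(1,2))

lemma C1_torus_divide:
  assumes "\<And>x. g x \<noteq> 0"
  shows "(\<lambda>x. f x / g x) \<in> C1_torus"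
  by (rule C1_torusI[where f' = "\<lambda>x. (deriv f x * g x - f x * deriv g x) / (g x * g x)"])
    (auto intro!: derivative_eq_intros continuous_intros facts simp: facts(1,2) assms)

lemma C1_torus_exp: "(\<lambda>x. exp (f x)) \<in> C1_torus"
  by (rule C1_torusI[where f' = "\<lambda>x. exp (f x) * deriv f x"])
    (auto intro!: derivative_eq_intros continuous_intros facts simp: facts(1,2))

end

lemmas [intro!] = C1_torus_add C1_torus_mult C1_torus_exp
lemmas [intro] = C1_torus_divide

lemma C1_torus_minus [intro!]: "f \<in> C1_torus \<Longrightarrow> (\<lambda>x. - f x) \<in> C1_torus"
  using C1_torus_mult[of "\<lambda>_. -1" f] by auto

lemma C1_torus_diff [intro!]: "f \<in> C1_torus \<Longrightarrow> g \<in> C1_torus \<Longrightarrow> (\<lambda>x. f x - g x) \<in> C1_torus"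
  using C1_torus_add[of f "\<lambda>x. - g x"] by auto

lemma C1_torus_power2 [intro!]: "f \<in> C1_torus \<Longrightarrow> (\<lambda>x. (f x)\<^sup>2) \<in> C1_torus"
  by (auto simp: power2_eq_square)

text \<open>
  Squaring removes the kink of the positive part.  This allows \<open>C\<^sup>1\<close> fields that are scaled by
  different constants on the two sides of a zero of \<open>b\<close>.
\<close>

lemma has_derivative_pos_part_square:
  "((\<lambda>y::real. (max y 0)\<^sup>2) has_real_derivative 2 * max y 0) (at y)"
proof (cases "y = 0")
  case True
  have "((\<lambda>h. ((max (0 + h) 0)\<^sup>2 - (max (0::real) 0)\<^sup>2) / h) \<longlongrightarrow> 0) (at 0)"
  proof (rule Lim_null_comparison)
    show "\<forall>\<^sub>F h in at 0. norm (((max (0 + h) 0)\<^sup>2 - (max (0::real) 0)\<^sup>2) / h) \<le> \<bar>h\<bar>"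
      by (auto simp: max_def power2_eq_square intro!: always_eventually)
    show "((\<lambda>h::real. \<bar>h\<bar>) \<longlongrightarrow> 0) (at 0)" by (intro tendsto_rabs_zero tendsto_ident_at)
  qed
  then show ?thesis using True by (simp add: DERIV_def)
next
  case False
  then consider "y > 0" | "y < 0" by linarith
  then show ?thesis
  proof cases
    case 1
    have "((\<lambda>y::real. y\<^sup>2) has_real_derivative 2 * max y 0) (at y)"
      using 1 by (auto intro!: derivative_eq_intros)
    then show ?thesis
      by (rule DERIV_cong_ev[THEN iffD1, rotated -1])
        (use 1 eventually_nhds_in_open[of "{0<..}" y] in \<open>auto elim!: eventually_mono\<close>)
  next
    case 2
    have "((\<lambda>y::real. 0) has_real_derivative 2 * max y 0) (at y)"
      using 2 by auto
    then show ?thesis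
      by (rule DERIV_cong_ev[THEN iffD1, rotated -1])
        (use 2 eventually_nhds_in_open[of "{..<0}" y] in \<open>auto elim!: eventually_mono\<close>)
  qed
qed

lemma C1_torus_pos_part_square [intro!]:
  assumes f: "f \<in> C1_torus"
  shows "(\<lambda>x. (max (f x) 0)\<^sup>2) \<in> C1_torus"
proof (rule C1_torusI)
  show "(max (f (x + 1)) 0)\<^sup>2 = (max (f x) 0)\<^sup>2" for x
    using f by (simp add: C1_torus_def)
  show "((\<lambda>x. (max (f x) 0)\<^sup>2) has_real_derivative 2 * max (f x) 0 * deriv f x) (at x)" for x
    using DERIV_chain2[OF has_derivative_pos_part_square C1_torus_has_derivative[OF f]] .
  have "continuous_on UNIV f" "continuous_on UNIV (deriv f)"
    using f C1_torus_subset_C0_torus by (auto simp: C0_torus_def C1_torus_def)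
  then show "continuous_on UNIV (\<lambda>x. 2 * max (f x) 0 * deriv f x)"
    by (intro continuous_intros)
qed

lemma exists_antiderivative:
  fixes G :: "real \<Rightarrow> real"
  assumes G: "continuous_on UNIV G"
  obtains H where "\<And>x. (H has_real_derivative G x) (at x)"
proof -
  define H where "H x = (LBINT y=ereal 0..ereal x. G y)" for x :: real
  have "(H has_real_derivative G x) (at x)" for x
  proof -
    have "(H has_vector_derivative G x) (at x within {min 0 (x - 1)..max 0 (x + 1)})"
      unfolding H_def
      by (rule interval_integral_FTC2) (auto intro: continuous_on_subset[OF G])
    then have "(H has_vector_derivative G x) (at x within {min 0 (x - 1)<..<max 0 (x + 1)})"
      by (rule has_vector_derivative_within_subset) auto
    moreover have "at x within {min 0 (x - 1)<..<max 0 (x + 1)} = at x"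
      by (rule at_within_open) auto
    ultimately show ?thesis
      by (simp add: has_real_derivative_iff_has_vector_derivative)
  qed
  then show ?thesis using that by blast
qed

text \<open>
  The increment of a primitive of \<open>G\<close> over one period is constant, and equals the mean of \<open>G\<close>.
\<close>

lemma C2_torus_primitive:
  assumes G: "G \<in> C1_torus" and mean: "integral {0..1} G = 0"
  obtains H where "H \<in> C2_torus" "deriv H = G"
proof -
  have cont: "continuous_on UNIV G"
    using G C1_torus_subset_C0_torus by (auto simp: C0_torus_def)
  obtain H where H: "\<And>x. (H has_real_derivative G x) (at x)"
    using exists_antiderivative[OF cont] by blast
  have "(G has_integral (H 1 - H 0)) {0..1}"
  proof (rule fundamental_theorem_of_calculus)
    fix x :: real
    show "(H has_vector_derivative G x) (at x within {0..1})"
      using has_field_derivative_at_within[OF H]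
      by (simp add: has_real_derivative_iff_has_vector_derivative)
  qed simp
  then have H01: "H 1 = H 0" using mean by (simp add: integral_unique)
  have "((\<lambda>x. H (x + 1) - H x) has_real_derivative G (x + 1) - G x) (at x)" for x
    using H[of "x + 1"] H[of x] by (intro DERIV_diff) (simp_all add: DERIV_shift)
  moreover have "G (x + 1) - G x = 0" for x using G by (simp add: C1_torus_def)
  ultimately have "H (x + 1) - H x = H (0 + 1) - H 0" for x
    by (intro DERIV_isconst_all[of "\<lambda>x. H (x + 1) - H x" x 0]) simp
  with H01 have per: "H (x + 1) = H x" for x by simp
  have dH: "deriv H = G" using H by (auto intro: DERIV_imp_deriv)
  have "H \<in> C1_torus" using C1_torusI[of H G, OF per H cont] .
  then show ?thesis
    using that dH G by (auto intro: C2_torusI)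
qed

section \<open>Measures on the torus and logarithmic test functions\<close>

lemma periodic_frac:
  fixes f :: "real \<Rightarrow> real"
  assumes per: "\<And>x. f (x + 1) = f x"
  shows "f (frac x) = f x"
proof -
  have nat: "f (y + real n) = f y" for y n
  proof (induction n)
    case (Suc n)
    then show ?case using per[of "y + real n"] by (simp add: algebra_simps)
  qed simp
  have "f (y + of_int k) = f y" for y and k :: int
    using nat[of y "nat k"] nat[of "y + of_int k" "nat (- k)"] by (cases "k \<ge> 0") auto
  from this[of x "- \<lfloor>x\<rfloor>"] show ?thesis by (simp add: frac_def)
qed

lemma C0_torus_frac: "f \<in> C0_torus \<Longrightarrow> f (frac x) = f x"
  by (intro periodic_frac) (simp add: C0_torus_def)

lemma C0_torus_bounded:
  assumes f: "f \<in> C0_torus"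
  obtains B where "B > 0" "\<And>x. \<bar>f x\<bar> \<le> B"
proof -
  have "compact (f ` {0..1})"
    using f by (intro compact_continuous_image)
      (auto simp: C0_torus_def intro: continuous_on_subset)
  then obtain B where B: "B > 0" "\<And>x. x \<in> {0..1} \<Longrightarrow> \<bar>f x\<bar> \<le> B"
    using compact_imp_bounded bounded_pos by (metis image_eqI real_norm_def)
  have "\<bar>f x\<bar> \<le> B" for x
    using B(2)[of "frac x"] C0_torus_frac[OF f, of x] frac_lt_1[of x] by (simp add: less_imp_le)
  then show ?thesis using that B(1) by blast
qed

lemma space_torus [simp]: "space torus = {0..<1}"
  by (simp add: torus_def space_restrict_space)

lemma C0_torus_borel: "f \<in> C0_torus \<Longrightarrow> f \<in> borel_measurable borel"
  by (auto simp: C0_torus_def intro: borel_measurable_continuous_onI)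

lemma C0_torus_measurable: "f \<in> C0_torus \<Longrightarrow> f \<in> borel_measurable torus"
  unfolding torus_def by (intro measurable_restrict_space1 C0_torus_borel)

lemma prob_torus_facts:
  assumes "\<mu> \<in> space (prob_algebra torus)"
  shows "prob_space \<mu>" "sets \<mu> = sets torus" "space \<mu> = {0..<1}"
  using assms sets_eq_imp_space_eq[of \<mu> torus] by (auto simp: space_prob_algebra)

lemma C0_torus_integrable:
  assumes \<mu>: "\<mu> \<in> space (prob_algebra torus)" and f: "f \<in> C0_torus"
  shows "integrable \<mu> f"
proof -
  interpret prob_space \<mu> using prob_torus_facts[OF \<mu>] by simp
  obtain B where B: "\<And>x. \<bar>f x\<bar> \<le> B" using C0_torus_bounded[OF f] by metis
  have "f \<in> borel_measurable \<mu>"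
    using C0_torus_measurable[OF f] prob_torus_facts(2)[OF \<mu>] measurable_cong_sets by blast
  then show ?thesis
    by (intro integrable_const_bound[of _ B]) (auto simp: B)
qed

text \<open>
  As an image of the discrete measure \<open>w\<close>, a combination of Dirac measures depends on \<open>w\<close> alone and
  not on the carrier set.  The map is the fractional part, which is the identity on the carrier
  and takes values in the torus everywhere, hence is measurable.
\<close>

lemma dirac_combination_eq_distr:
  assumes "finite S" "S \<subseteq> {0..<1}" "set_pmf w \<subseteq> S"
  shows "dirac_combination S w = distr (measure_pmf w) torus frac"
proof (rule measure_eqI)
  fix A assume "A \<in> sets (dirac_combination S w)"
  then have A: "A \<in> sets torus" by simp
  have frac: "frac \<in> measurable (measure_pmf w) torus"
    by (auto simp: measurable_def frac_lt_1)
  have "emeasure (distr (measure_pmf w) torus frac) A = emeasure (measure_pmf w) (frac -` A)"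
    using A frac by (simp add: emeasure_distr)
  also have "\<dots> = emeasure (measure_pmf w) ((frac -` A) \<inter> set_pmf w)"
    by (simp add: emeasure_Int_set_pmf)
  also have "(frac -` A) \<inter> set_pmf w = (S \<inter> A) \<inter> set_pmf w"
    using assms by (force simp: frac_eq)
  also have "emeasure (measure_pmf w) \<dots> = emeasure (measure_pmf w) (S \<inter> A)"
    by (rule emeasure_Int_set_pmf)
  also have "\<dots> = (\<Sum>z\<in>S \<inter> A. ennreal (pmf w z))"
    using assms(1) by (simp add: emeasure_measure_pmf_finite)
  also have "\<dots> = (\<Sum>z\<in>S. ennreal (pmf w z) * indicator A z)"
    using assms(1) by (simp add: sum.inter_restrict indicator_def if_distrib cong: if_cong)
  finally show "emeasure (dirac_combination S w) A = emeasure (distr (measure_pmf w) torus frac) A"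
    using A by (simp add: emeasure_dirac_combination)
qed simp

lemma integral_dirac_combination:
  assumes S: "finite S" "S \<subseteq> {0..<1}" "set_pmf w \<subseteq> S" and f: "f \<in> C0_torus"
  shows "(\<integral>x. f x \<partial>dirac_combination S w) = (\<Sum>z\<in>S. pmf w z * f z)"
proof -
  have "frac \<in> measurable (measure_pmf w) torus"
    by (auto simp: measurable_def frac_lt_1)
  then have "(\<integral>x. f x \<partial>dirac_combination S w) = (\<integral>x. f (frac x) \<partial>measure_pmf w)"
    using C0_torus_measurable[OF f]
    by (simp add: dirac_combination_eq_distr[OF S] integral_distr)
  also have "\<dots> = (\<Sum>z\<in>S. pmf w z * f z)"
    using integral_measure_pmf_real[OF S(1), of w f] S(3) C0_torus_frac[OF f]
    by (auto simp: mult.commute)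
  finally show ?thesis .
qed

lemma concentrated_imp_dirac_combination:
  assumes S: "finite S" "S \<subseteq> {0..<1}" and \<mu>: "\<mu> \<in> space (prob_algebra torus)"
    and conc: "AE x in \<mu>. x \<in> S"
  obtains w where "set_pmf w \<subseteq> S" "\<mu> = dirac_combination S w"
proof -
  note facts = prob_torus_facts[OF \<mu>]
  interpret prob_space \<mu> by (rule facts)
  have sing: "{z} \<in> sets \<mu>" if "z \<in> S" for z
    using that S facts(2) by (auto simp: torus_def sets_restrict_space_iff)
  have em: "emeasure \<mu> A = (\<Sum>z\<in>S. emeasure \<mu> {z} * indicator A z)" if "A \<in> sets \<mu>" for A
  proof -
    have SA: "S \<inter> A \<in> sets \<mu>"
      using sing S(1) sets.countable[of "S \<inter> A" \<mu>] by (auto intro: countable_finite)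
    have "emeasure \<mu> A = emeasure \<mu> (S \<inter> A)"
      using conc that SA by (intro emeasure_eq_AE) auto
    also have "\<dots> = (\<Sum>z\<in>S \<inter> A. emeasure \<mu> {z})"
      using S(1) sing by (intro emeasure_eq_sum_singleton) auto
    also have "\<dots> = (\<Sum>z\<in>S. emeasure \<mu> {z} * indicator A z)"
      using S(1) by (simp add: sum.inter_restrict indicator_def if_distrib cong: if_cong)
    finally show ?thesis .
  qed
  define p where "p z = (if z \<in> S then prob {z} else 0)" for z
  have "(\<integral>\<^sup>+z. ennreal (p z) \<partial>count_space UNIV) = (\<Sum>z\<in>S. ennreal (p z))"
    using S(1) by (intro nn_integral_count_space'[of S]) (auto simp: p_def)
  also have "\<dots> = (\<Sum>z\<in>S. emeasure \<mu> {z} * indicator (space \<mu>) z)"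
    using S(2) by (intro sum.cong) (auto simp: p_def emeasure_eq_measure facts(3))
  also have "\<dots> = emeasure \<mu> (space \<mu>)"
    by (rule em[symmetric]) simp
  finally have one: "(\<integral>\<^sup>+z. ennreal (p z) \<partial>count_space UNIV) = 1"
    by (simp add: emeasure_space_1)
  have pmf: "pmf (embed_pmf p) z = p z" for z
    using one by (intro pmf_embed_pmf) (auto simp: p_def)
  show ?thesis
  proof
    show "set_pmf (embed_pmf p) \<subseteq> S"
      by (auto simp: set_pmf_iff pmf p_def split: if_splits)
    show "\<mu> = dirac_combination S (embed_pmf p)"
    proof (rule measure_eqI)
      fix A assume A: "A \<in> sets \<mu>"
      then have "emeasure (dirac_combination S (embed_pmf p)) A
          = (\<Sum>z\<in>S. emeasure \<mu> {z} * indicator A z)"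
        using facts(2) by (simp add: emeasure_dirac_combination pmf p_def emeasure_eq_measure)
      then show "emeasure \<mu> A = emeasure (dirac_combination S (embed_pmf p)) A"
        by (simp only: em[OF A])
    qed (simp add: facts)
  qed
qed

text \<open>
  The quotient \<open>L\<^sub>\<epsilon> u / u\<close> in the definition of the rate involves only the logarithmic derivative
  of \<open>u\<close>.
\<close>

lemma generator_exp:
  assumes "H \<in> C2_torus"
  shows "(\<lambda>x. exp (H x)) \<in> C2_torus"
    and "generator a b \<epsilon> (\<lambda>x. exp (H x)) x / exp (H x)
      = b x * deriv H x + \<epsilon> * a x * (deriv (deriv H) x + (deriv H x)\<^sup>2)"
proof -
  have H1: "H \<in> C1_torus" "deriv H \<in> C1_torus"
    using assms C2_torus_subset_C1_torus deriv_C2_torus by auto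
  have d1: "deriv (\<lambda>x. exp (H x)) = (\<lambda>x. exp (H x) * deriv H x)"
    using DERIV_chain2[OF DERIV_exp C1_torus_has_derivative[OF H1(1)]]
    by (auto intro!: DERIV_imp_deriv)
  have d2: "deriv (\<lambda>x. exp (H x) * deriv H x) x
      = exp (H x) * deriv H x * deriv H x + deriv (deriv H) x * exp (H x)" for x
    by (intro DERIV_imp_deriv DERIV_mult DERIV_chain2[OF DERIV_exp] C1_torus_has_derivative H1)
  show "(\<lambda>x. exp (H x)) \<in> C2_torus"
    using H1 by (intro C2_torusI) (auto simp: d1)
  show "generator a b \<epsilon> (\<lambda>x. exp (H x)) x / exp (H x)
      = b x * deriv H x + \<epsilon> * a x * (deriv (deriv H) x + (deriv H x)\<^sup>2)"
    unfolding generator_def d1 d2 by (simp add: field_simps power2_eq_square)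
qed

text \<open>
  A mean-zero field \<open>G\<close> is the logarithmic derivative of an admissible test function, and so is
  every multiple \<open>c G\<close>.  Large constants \<open>c\<close> detect mass away from the zeros of \<open>b\<close>; the scale
  \<open>c = 1 / \<epsilon>\<close> resolves the neighbourhoods of the zeros.
\<close>

lemma rate_ge:
  assumes G: "G \<in> C1_torus" "integral {0..1} G = 0"
  shows "ereal (- (\<integral>x. b x * (c * G x) + \<epsilon> * a x * (c * deriv G x + (c * G x)\<^sup>2) \<partial>\<mu>)) \<le> rate a b \<epsilon> \<mu>"
proof -
  let ?G = "\<lambda>x. c * G x"
  have "?G \<in> C1_torus" "integral {0..1} ?G = 0"
    using G by auto
  then obtain H where H: "H \<in> C2_torus" "deriv H = ?G" by (rule C2_torus_primitive)
  have dG: "deriv ?G x = c * deriv G x" for x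
    by (intro DERIV_imp_deriv DERIV_cmult C1_torus_has_derivative G)
  show ?thesis
    unfolding rate_def
    using generator_exp[OF H(1)] H(2) dG
    by (intro SUP_upper2[of "\<lambda>x. exp (H x)"]) auto
qed

section \<open>Mass away from the zeros of the drift\<close>

lemma integral_torus_pos:
  assumes f: "f \<in> C0_torus" and nonneg: "\<And>x. f x \<ge> 0" and pos: "f x0 > 0"
  shows "integral {0..1} f > 0"
proof -
  have cont: "continuous_on {0..1} f"
    using f by (auto simp: C0_torus_def intro: continuous_on_subset)
  have "integral {0..1} f \<noteq> 0"
  proof
    assume "integral {0..1} f = 0"
    then have "\<forall>x\<in>cbox 0 1. f x = 0"
      using integral_cbox_eq_0_iff[of 0 1 f] cont nonneg by simp
    then have "f (frac x0) = 0" by (simp add: less_imp_le frac_lt_1)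
    then show False using pos C0_torus_frac[OF f] by simp
  qed
  moreover have "integral {0..1} f \<ge> 0"
    by (intro integral_nonneg integrable_continuous_interval cont nonneg)
  ultimately show ?thesis by simp
qed

lemma C0_torus_integrable_on: "f \<in> C0_torus \<Longrightarrow> f integrable_on {l..r}"
  by (auto simp: C0_torus_def intro: integrable_continuous_interval continuous_on_subset)

lemma mean_zero_combination:
  assumes F: "F \<in> C0_torus" and G: "G \<in> C0_torus"
    and sgn: "integral {0..1} F < 0" "integral {0..1} G > 0"
  obtains \<theta> where "0 < \<theta>" "\<theta> < 1" "integral {0..1} (\<lambda>x. \<theta> * F x + (1 - \<theta>) * G x) = 0"
proof -
  define \<theta> where "\<theta> = integral {0..1} G / (integral {0..1} G - integral {0..1} F)"
  have "0 < \<theta>" "\<theta> < 1" using sgn by (auto simp: \<theta>_def divide_simps)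
  moreover have "integral {0..1} (\<lambda>x. \<theta> * F x + (1 - \<theta>) * G x)
      = \<theta> * integral {0..1} F + (1 - \<theta>) * integral {0..1} G"
    by (subst integral_add) (auto intro!: C0_torus_integrable_on C0_torus_mult F G)
  moreover have "\<theta> * integral {0..1} F + (1 - \<theta>) * integral {0..1} G = 0"
    using sgn by (simp add: \<theta>_def field_simps)
  ultimately show ?thesis using that by auto
qed

text \<open>
  In the main application \<open>D\<close> is the derivative of \<open>f\<close>: close to a zero with positive slope, \<open>f\<close> takes
  both signs at points where the slope is still positive.
\<close>

lemma positive_slope_signs:
  assumes f: "f \<in> C1_torus" and D: "D \<in> C0_torus" and z: "f z = 0" "deriv f z > 0" "D z > 0"
  obtains x y where "f x < 0" "D x > 0" "f y > 0" "D y > 0"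
proof -
  have "isCont D z" using D by (simp add: C0_torus_def continuous_on_eq_continuous_at)
  then have "\<forall>\<^sub>F x in nhds z. D x > 0"
    using z(3) by (intro order_tendstoD(1)[of D "D z"]) (simp_all add: isCont_def tendsto_at_iff_tendsto_nhds)
  then obtain d1 where d1: "d1 > 0" "\<And>x. dist x z < d1 \<Longrightarrow> D x > 0"
    unfolding eventually_nhds_metric by blast
  obtain d2 where d2: "d2 > 0" "\<And>h. 0 < h \<Longrightarrow> h < d2 \<Longrightarrow> f z < f (z + h)"
    using DERIV_pos_inc_right[OF C1_torus_has_derivative[OF f] z(2)] by blast
  obtain d3 where d3: "d3 > 0" "\<And>h. 0 < h \<Longrightarrow> h < d3 \<Longrightarrow> f (z - h) < f z"
    using DERIV_pos_inc_left[OF C1_torus_has_derivative[OF f] z(2)] by blast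
  define h where "h = min d1 (min d2 d3) / 2"
  have "0 < h" "h < d1" "h < d2" "h < d3"
    using d1(1) d2(1) d3(1) by (auto simp: h_def)
  then show ?thesis
    using that[of "z - h" "z + h"] d1(2)[of "z - h"] d1(2)[of "z + h"] d2(2)[of h] d3(2)[of h] z(1)
    by (simp add: dist_real_def)
qed

lemma simple_zero_signs:
  assumes f: "f \<in> C1_torus" and z: "f z = 0" "deriv f z \<noteq> 0"
  obtains x y where "f x < 0" "f y > 0"
proof (cases "deriv f z > 0")
  case True
  then show ?thesis
    using positive_slope_signs[OF f C0_torus_const[of 1] z(1) True] that by auto
next
  case False
  have d: "deriv (\<lambda>x. - f x) z = - deriv f z"
    by (intro DERIV_imp_deriv DERIV_minus C1_torus_has_derivative f)
  have "deriv (\<lambda>x. - f x) z > 0" "- f z = 0" using z d False by simp_all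
  from positive_slope_signs[OF C1_torus_minus[OF f] C0_torus_const[of 1] this(2,1)]
  obtain x y where "- f x < 0" "- f y > 0" by auto
  then show ?thesis using that by auto
qed

text \<open>
  The fields \<open>- b\<^sub>+\<^sup>2\<close> and \<open>b\<^sub>-\<^sup>2\<close> both point against \<open>b\<close>, are \<open>C\<^sup>1\<close>, and have means of opposite sign,
  so a strictly convex combination of them has mean zero and vanishes only where \<open>b\<close> does.
\<close>

lemma exists_descent_direction:
  assumes b: "b \<in> C1_torus" and z: "b z = 0" "deriv b z \<noteq> 0"
  obtains G where "G \<in> C1_torus" "integral {0..1} G = 0"
    "\<And>x. b x * G x \<le> 0" "\<And>x. b x * G x = 0 \<Longrightarrow> b x = 0"
proof -
  have b0: "b \<in> C0_torus" using b C1_torus_subset_C0_torus by auto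
  let ?F = "\<lambda>x. - (max (b x) 0)\<^sup>2" and ?G = "\<lambda>x. (max (- b x) 0)\<^sup>2"
  have FG: "?F \<in> C1_torus" "?G \<in> C1_torus" using b by auto
  note FG0 = FG[THEN C1_torus_subset_C0_torus[THEN subsetD]]
  obtain x y where xy: "b x < 0" "b y > 0" using simple_zero_signs[OF b z] .
  have "integral {0..1} (\<lambda>x. (max (b x) 0)\<^sup>2) > 0"
    using xy b0 by (intro integral_torus_pos[of _ y]) auto
  then have "integral {0..1} ?F < 0" by simp
  moreover have "integral {0..1} ?G > 0"
    using xy b0 by (intro integral_torus_pos[of _ x]) auto
  ultimately obtain \<theta> where \<theta>: "0 < \<theta>" "\<theta> < 1"
    "integral {0..1} (\<lambda>x. \<theta> * ?F x + (1 - \<theta>) * ?G x) = 0"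
    using mean_zero_combination[OF FG0] by blast
  have prod: "b x * (\<theta> * ?F x + (1 - \<theta>) * ?G x) = - ((if b x > 0 then \<theta> else 1 - \<theta>) * \<bar>b x\<bar> ^ 3)" for x
    by (auto simp: max_def power2_eq_square power3_eq_cube)
  show ?thesis
  proof
    show "(\<lambda>x. \<theta> * ?F x + (1 - \<theta>) * ?G x) \<in> C1_torus" using b by auto
    show "b x * (\<theta> * ?F x + (1 - \<theta>) * ?G x) \<le> 0" for x
      unfolding prod using \<theta> by simp
    show "b x = 0" if "b x * (\<theta> * ?F x + (1 - \<theta>) * ?G x) = 0" for x
      using that \<theta> unfolding prod by (auto split: if_splits)
  qed (rule \<theta>)
qed

lemma Liminf_at_right_ge:
  assumes le: "\<And>\<epsilon>. \<epsilon> > 0 \<Longrightarrow> ereal (g \<epsilon>) \<le> F \<epsilon>" and lim: "(g \<longlongrightarrow> L) (at_right (0::real))"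
  shows "ereal L \<le> Liminf (at_right 0) F"
proof -
  have "ereal L = Liminf (at_right 0) (\<lambda>\<epsilon>. ereal (g \<epsilon>))"
    using lim by (intro lim_imp_Liminf[symmetric]) (auto intro: tendsto_ereal)
  also have "\<dots> \<le> Liminf (at_right 0) F"
    using le by (intro Liminf_mono) (auto simp: eventually_at_right_less eventually_at_filter)
  finally show ?thesis .
qed

text \<open>
  A measure charging \<open>{b \<noteq> 0}\<close> has \<open>I = - \<integral> b G d\<mu> > 0\<close> for the descent field \<open>G\<close>.  Since the
  second-order part of the generator is multiplied by \<open>\<epsilon>\<close>, the test field \<open>c G\<close> gives the lower
  bound \<open>c I\<close> in the limit, for every constant \<open>c\<close>.
\<close>

lemma Liminf_rate_infinite:
  assumes a: "a \<in> C0_torus" and b: "b \<in> C1_torus" and z: "b z = 0" "deriv b z \<noteq> 0"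
    and \<mu>: "\<mu> \<in> space (prob_algebra torus)"
    and m: "\<And>\<epsilon>. \<epsilon> > 0 \<Longrightarrow> m \<epsilon> \<in> space (prob_algebra torus)"
    and lim: "\<And>f. f \<in> C0_torus \<Longrightarrow> ((\<lambda>\<epsilon>. \<integral>x. f x \<partial>m \<epsilon>) \<longlongrightarrow> (\<integral>x. f x \<partial>\<mu>)) (at_right 0)"
    and off: "\<not> (AE x in \<mu>. b x = 0)"
  shows "Liminf (at_right 0) (\<lambda>\<epsilon>. rate a b \<epsilon> (m \<epsilon>)) = \<infinity>"
proof -
  obtain G where G: "G \<in> C1_torus" "integral {0..1} G = 0"
    and descent: "\<And>x. b x * G x \<le> 0" "\<And>x. b x * G x = 0 \<Longrightarrow> b x = 0"
    using exists_descent_direction[OF b z] by blast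
  have C0: "b \<in> C0_torus" "G \<in> C0_torus" "deriv G \<in> C0_torus"
    using b G C1_torus_subset_C0_torus deriv_C1_torus by auto
  define I where "I = (\<integral>x. - (b x * G x) \<partial>\<mu>)"
  have int: "integrable \<mu> (\<lambda>x. - (b x * G x))"
    using C0 by (intro C0_torus_integrable \<mu>) auto
  have "I \<noteq> 0"
  proof
    assume "I = 0"
    then have "AE x in \<mu>. - (b x * G x) = 0"
      using integral_nonneg_eq_0_iff_AE[OF int] descent(1) by (simp add: I_def)
    then have "AE x in \<mu>. b x = 0"
      by eventually_elim (intro descent(2), simp)
    then show False using off by simp
  qed
  moreover have "I \<ge> 0"
    unfolding I_def using descent(1) by (intro Bochner_Integration.integral_nonneg) simp
  ultimately have I: "I > 0" by simp
  have "ereal (c * I) \<le> Liminf (at_right 0) (\<lambda>\<epsilon>. rate a b \<epsilon> (m \<epsilon>))" for c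
  proof (rule Liminf_at_right_ge)
    let ?R = "\<lambda>x. a x * (c * deriv G x + (c * G x)\<^sup>2)"
    let ?g = "\<lambda>\<epsilon>. c * (\<integral>x. - (b x * G x) \<partial>m \<epsilon>) - \<epsilon> * (\<integral>x. ?R x \<partial>m \<epsilon>)"
    have R: "?R \<in> C0_torus" using C0 a by auto
    have bG: "(\<lambda>x. - (b x * G x)) \<in> C0_torus" using C0 by auto
    show "ereal (?g \<epsilon>) \<le> rate a b \<epsilon> (m \<epsilon>)" if "\<epsilon> > 0" for \<epsilon>
    proof -
      note int = C0_torus_integrable[OF m[OF that]]
      have "?g \<epsilon> = - (\<integral>x. - c * - (b x * G x) + \<epsilon> * ?R x \<partial>m \<epsilon>)"
        using int[OF bG] int[OF R]
        by (subst Bochner_Integration.integral_add) simp_all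
      also have "\<dots> = - (\<integral>x. b x * (c * G x) + \<epsilon> * a x * (c * deriv G x + (c * G x)\<^sup>2) \<partial>m \<epsilon>)"
        by (simp add: algebra_simps)
      finally show ?thesis using rate_ge[OF G, where b = b and c = c and \<epsilon> = \<epsilon> and a = a and \<mu> = "m \<epsilon>"] by simp
    qed
    have "(?g \<longlongrightarrow> c * I - 0 * (\<integral>x. ?R x \<partial>\<mu>)) (at_right 0)"
      unfolding I_def by (intro tendsto_intros lim R bG)
    then show "(?g \<longlongrightarrow> c * I) (at_right 0)" by simp
  qed
  from this[of "c / I" for c] I
  have "ereal c \<le> Liminf (at_right 0) (\<lambda>\<epsilon>. rate a b \<epsilon> (m \<epsilon>))" for c by simp
  then show ?thesis by (rule ereal_top)
qed

section \<open>Lower bound for mass on the zeros of the drift\<close>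

text \<open>
  Here \<open>f\<close> and \<open>g\<close> stand for the two one-sided parts of \<open>b\<close>, in either order.  A large weight \<open>K\<close> on
  \<open>f\<^sup>2\<close> in the denominator leaves the integrand unchanged where \<open>f\<close> vanishes, while by the inequality
  of arithmetic and geometric means it is of order \<open>1 / sqrt K\<close> where \<open>f\<close> is positive; so the negative
  contribution of \<open>g\<close> prevails.
\<close>

lemma suppress_one_side:
  assumes C0: "a \<in> C0_torus" "D \<in> C0_torus" "Q \<in> C0_torus" "f \<in> C0_torus" "g \<in> C0_torus"
    and a: "c0 > 0" "\<And>x. a x \<ge> c0"
    and Q: "\<And>x. 0 \<le> Q x" "\<And>x. Q x \<le> (D x)\<^sup>2"
    and fg: "\<And>x. f x \<ge> 0" "\<And>x. g x \<ge> 0" "\<And>x. f x = 0 \<or> g x = 0"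
    and nz: "\<And>x. (D x)\<^sup>2 + (f x)\<^sup>2 + (g x)\<^sup>2 > 0"
    and x0: "Q x0 > 0" "g x0 > 0"
  obtains K where "K \<ge> 1"
    "integral {0..1} (\<lambda>x. Q x * (f x - g x) / (a x * ((D x)\<^sup>2 + K * (f x)\<^sup>2 + (g x)\<^sup>2))) < 0"
proof -
  let ?N = "\<lambda>K x. (D x)\<^sup>2 + K * (f x)\<^sup>2 + (g x)\<^sup>2"
  have Npos: "?N K x > 0" if "K \<ge> 1" for K x
  proof -
    have "(f x)\<^sup>2 \<le> K * (f x)\<^sup>2" using that by (simp add: mult_le_cancel_right1)
    with nz[of x] show ?thesis by linarith
  qed
  have apos: "a x > 0" for x using a(1) a(2)[of x] by linarith
  have C0N: "(\<lambda>x. Q x * h x / (a x * ?N K x)) \<in> C0_torus" if "h \<in> C0_torus" "K \<ge> 1" for h K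
    using C0 that Npos[OF that(2)] apos by (intro C0_torus_divide) (auto simp: less_imp_neq[symmetric])
  define c where "c = integral {0..1} (\<lambda>x. Q x * g x / (a x * ?N 1 x))"
  have c: "c > 0"
    unfolding c_def using x0 fg Q Npos[of 1] apos C0
    by (intro integral_torus_pos[of _ x0] C0N) (auto intro!: divide_nonneg_pos mult_pos_pos)
  obtain M where M: "M > 0" "\<And>x. \<bar>D x\<bar> \<le> M" using C0_torus_bounded[OF C0(2)] by metis
  \<comment> \<open>With \<open>K = k\<^sup>2\<close> the part with \<open>f\<close> is at most \<open>M / (2 k c0)\<close>, and this is at most \<open>c / 2\<close>.\<close>
  define k where "k = max 1 (M / (c0 * c))"
  have k: "k \<ge> 1" "M \<le> k * (c0 * c)"
    using a(1) c by (auto simp: k_def max_def divide_simps split: if_splits)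
  have K: "k\<^sup>2 \<ge> 1" using k by simp
  have F_le: "Q x * f x / (a x * ?N (k\<^sup>2) x) \<le> c / 2" for x
  proof -
    have "2 * (k * f x * \<bar>D x\<bar>) \<le> (k * f x)\<^sup>2 + \<bar>D x\<bar>\<^sup>2"
      using sum_squares_bound[of "k * f x" "\<bar>D x\<bar>"] by (simp add: algebra_simps)
    also have "\<dots> \<le> ?N (k\<^sup>2) x" by (simp add: power_mult_distrib)
    finally have N: "2 * k * (\<bar>D x\<bar> * f x) \<le> ?N (k\<^sup>2) x" by (simp add: algebra_simps)
    have DD: "(D x)\<^sup>2 = \<bar>D x\<bar> * \<bar>D x\<bar>" by (simp add: power2_eq_square)
    have "2 * k * (Q x * f x) \<le> 2 * k * ((D x)\<^sup>2 * f x)"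
      using Q fg k by (intro mult_left_mono mult_right_mono) auto
    also have "\<dots> = \<bar>D x\<bar> * (2 * k * (\<bar>D x\<bar> * f x))"
      unfolding DD by (simp only: mult_ac)
    also have "\<dots> \<le> M * ?N (k\<^sup>2) x"
      using N M(2)[of x] M(1) fg k by (intro mult_mono) auto
    also have "\<dots> \<le> k * (c0 * c) * ?N (k\<^sup>2) x"
      using k Npos[OF K, of x] by (intro mult_right_mono) auto
    also have "\<dots> = k * (c * (c0 * ?N (k\<^sup>2) x))" by (simp add: algebra_simps)
    also have "\<dots> \<le> k * (c * (a x * ?N (k\<^sup>2) x))"
      using k c a(2)[of x] Npos[OF K, of x] by (intro mult_left_mono mult_right_mono) auto
    finally have "2 * (Q x * f x) \<le> c * (a x * ?N (k\<^sup>2) x)"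
      using k(1) by (simp add: mult.assoc mult.left_commute[of 2])
    then show ?thesis
      using mult_pos_pos[OF apos[of x] Npos[OF K, of x]] by (simp add: pos_divide_le_eq)
  qed
  have g_eq: "Q x * g x / (a x * ?N (k\<^sup>2) x) = Q x * g x / (a x * ?N 1 x)" for x
    using fg(3)[of x] by auto
  have int: "(\<lambda>x. Q x * f x / (a x * ?N (k\<^sup>2) x)) integrable_on {0..1}"
    "(\<lambda>x. Q x * g x / (a x * ?N (k\<^sup>2) x)) integrable_on {0..1}"
    by (intro C0_torus_integrable_on C0N C0 K)+
  have "integral {0..1} (\<lambda>x. Q x * (f x - g x) / (a x * ?N (k\<^sup>2) x))
      = integral {0..1} (\<lambda>x. Q x * f x / (a x * ?N (k\<^sup>2) x)) - c"
    unfolding c_def g_eq[symmetric] integral_diff[OF int, symmetric]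
    by (simp only: right_diff_distrib diff_divide_distrib)
  also have "integral {0..1} (\<lambda>x. Q x * f x / (a x * ?N (k\<^sup>2) x)) \<le> integral {0..1} (\<lambda>x::real. c / 2)"
    by (intro integral_le F_le C0_torus_integrable_on C0N C0 K) auto
  also have "\<dots> = c / 2" by simp
  finally show ?thesis using that[OF K] c by simp
qed

text \<open>
  Take \<open>G = - \<psi> b / a\<close> with \<open>0 \<le> \<psi> \<le> 1\<close>, so that \<open>b G + a G\<^sup>2 = - \<psi> (1 - \<psi>) b\<^sup>2 / a\<close>, and with
  \<open>\<psi> = 1\<close> at the unstable and \<open>\<psi> = 0\<close> at the stable zeros.  The quotients
  \<open>(b'\<^sub>+)\<^sup>2 / (b'\<^sup>2 + p b\<^sub>+\<^sup>2 + q b\<^sub>-\<^sup>2)\<close> have all these properties for every \<open>p, q \<ge> 1\<close>, and so have their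
  convex combinations.  If there is an unstable zero, the means of the fields for large \<open>p\<close> and for
  large \<open>q\<close> have opposite signs, and some convex combination has mean zero; otherwise \<open>G = 0\<close> will do.
\<close>

lemma exists_reversing_field:
  assumes a: "a \<in> C1_torus" "c0 > 0" "\<And>x. a x \<ge> c0" and b: "b \<in> C2_torus"
    and nd: "\<And>x. b x = 0 \<Longrightarrow> deriv b x \<noteq> 0"
  obtains G where "G \<in> C1_torus" "integral {0..1} G = 0"
    "\<And>x. b x * G x + a x * (G x)\<^sup>2 \<le> 0"
    "\<And>z. b z = 0 \<Longrightarrow> - (a z * deriv G z) = max (deriv b z) 0"
proof (cases "\<exists>z. b z = 0 \<and> deriv b z > 0")
  case False
  show ?thesis
  proof
    show "(\<lambda>_. 0) \<in> C1_torus" by auto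
    show "- (a z * deriv (\<lambda>_. 0) z) = max (deriv b z) 0" if "b z = 0" for z
      using False that by (force simp: max_def)
  qed auto
next
  case True
  then obtain z where z: "b z = 0" "deriv b z > 0" by blast
  have apos: "a x > 0" for x using a(2) a(3)[of x] by linarith
  have bC1: "b \<in> C1_torus" "deriv b \<in> C1_torus"
    using b C2_torus_subset_C1_torus deriv_C2_torus by auto
  let ?D = "deriv b"
  let ?Q = "\<lambda>x. (max (?D x) 0)\<^sup>2" and ?f = "\<lambda>x. max (b x) 0" and ?g = "\<lambda>x. max (- b x) 0"
  have C0: "a \<in> C0_torus" "?D \<in> C0_torus" "?Q \<in> C0_torus" "?f \<in> C0_torus" "?g \<in> C0_torus"
    using bC1[THEN C1_torus_subset_C0_torus[THEN subsetD]] a(1) C1_torus_subset_C0_torus by auto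
  have Q: "0 \<le> ?Q x" "?Q x \<le> (?D x)\<^sup>2" for x by (auto simp: max_def)
  define N where "N p q x = (?D x)\<^sup>2 + p * (?f x)\<^sup>2 + q * (?g x)\<^sup>2" for p q x
  have N11: "(?D x)\<^sup>2 + (?f x)\<^sup>2 + (?g x)\<^sup>2 > 0" for x
  proof (cases "b x = 0")
    case True
    then show ?thesis using nd by simp
  next
    case False
    then have "(?f x)\<^sup>2 + (?g x)\<^sup>2 > 0" by (auto simp: max_def)
    then show ?thesis using zero_le_power2[of "?D x"] by linarith
  qed
  have Npos: "N p q x > 0" if "p \<ge> 1" "q \<ge> 1" for p q x
  proof -
    have "(?f x)\<^sup>2 \<le> p * (?f x)\<^sup>2" "(?g x)\<^sup>2 \<le> q * (?g x)\<^sup>2"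
      using that by (simp_all add: mult_le_cancel_right1)
    then show ?thesis using N11[of x] unfolding N_def by linarith
  qed
  define A where "A p q x = ?Q x / N p q x" for p q x
  have AC1: "A p q \<in> C1_torus" if "p \<ge> 1" "q \<ge> 1" for p q
  proof -
    have "N p q \<in> C1_torus" unfolding N_def[abs_def] using bC1 by auto
    then show ?thesis
      unfolding A_def[abs_def] using bC1 Npos[OF that] by (intro C1_torus_divide) (auto simp: less_imp_neq[symmetric])
  qed
  have A01: "0 \<le> A p q x" "A p q x \<le> 1" if "p \<ge> 1" "q \<ge> 1" for p q x
  proof -
    have "?Q x \<le> N p q x" unfolding N_def using Q(2)[of x] that
      by (auto intro!: order_trans[OF Q(2)] simp: add.assoc)
    then show "0 \<le> A p q x" "A p q x \<le> 1" using Npos[OF that, of x] by (auto simp: A_def)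
  qed
  have Az: "A p q x * ?D x = max (?D x) 0" if "b x = 0" for p q x
    using that nd[OF that] by (auto simp: A_def N_def max_def)
  obtain x y where xy: "b x < 0" "?D x > 0" "b y > 0" "?D y > 0"
    using positive_slope_signs[OF bC1(1) C0(2) z z(2)] by blast
  obtain K1 where K1: "K1 \<ge> 1"
    "integral {0..1} (\<lambda>x. ?Q x * (?f x - ?g x) / (a x * ((?D x)\<^sup>2 + K1 * (?f x)\<^sup>2 + (?g x)\<^sup>2))) < 0"
    by (rule suppress_one_side[OF C0 a(2,3) Q _ _ _ N11, of x]) (use xy in auto)
  obtain K2 where K2: "K2 \<ge> 1"
    "integral {0..1} (\<lambda>x. ?Q x * (?g x - ?f x) / (a x * ((?D x)\<^sup>2 + K2 * (?g x)\<^sup>2 + (?f x)\<^sup>2))) < 0"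
    by (rule suppress_one_side[OF C0(1,2,3,5,4) a(2,3) Q _ _ _, of y]) (use xy N11 in \<open>auto simp: add_ac\<close>)
  let ?F1 = "\<lambda>x. A K1 1 x * b x / a x" and ?F2 = "\<lambda>x. A 1 K2 x * b x / a x"
  have FC1: "?F1 \<in> C1_torus" "?F2 \<in> C1_torus"
    using AC1[of K1 1] AC1[of 1 K2] K1 K2 bC1 a(1) apos
    by (auto intro!: C1_torus_divide simp: less_imp_neq[symmetric])
  have F1: "?F1 = (\<lambda>x. ?Q x * (?f x - ?g x) / (a x * ((?D x)\<^sup>2 + K1 * (?f x)\<^sup>2 + (?g x)\<^sup>2)))"
    by (rule ext) (auto simp: A_def N_def max_def)
  have F2: "?F2 = (\<lambda>x. - (?Q x * (?g x - ?f x) / (a x * ((?D x)\<^sup>2 + K2 * (?g x)\<^sup>2 + (?f x)\<^sup>2))))"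
    by (rule ext) (auto simp: A_def N_def max_def)
  have "integral {0..1} ?F1 < 0" unfolding F1 by (rule K1)
  moreover have "integral {0..1} ?F2 > 0" unfolding F2 using K2(2) by (simp only: integral_neg)
  ultimately obtain \<theta> where \<theta>: "0 < \<theta>" "\<theta> < 1"
    and mean: "integral {0..1} (\<lambda>x. \<theta> * ?F1 x + (1 - \<theta>) * ?F2 x) = 0"
    using mean_zero_combination[OF FC1[THEN C1_torus_subset_C0_torus[THEN subsetD]]] by blast
  define \<psi> where "\<psi> x = \<theta> * A K1 1 x + (1 - \<theta>) * A 1 K2 x" for x
  have \<psi>C1: "\<psi> \<in> C1_torus"
    unfolding \<psi>_def[abs_def] using AC1[of K1 1] AC1[of 1 K2] K1 K2 by auto
  have \<psi>01: "0 \<le> \<psi> x" "\<psi> x \<le> 1" for x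
  proof -
    show "0 \<le> \<psi> x" unfolding \<psi>_def using A01[of K1 1 x] A01[of 1 K2 x] K1 K2 \<theta> by auto
    have "\<psi> x \<le> \<theta> * 1 + (1 - \<theta>) * 1"
      unfolding \<psi>_def using A01[of K1 1 x] A01[of 1 K2 x] K1 K2 \<theta>
      by (intro add_mono mult_left_mono) auto
    then show "\<psi> x \<le> 1" by simp
  qed
  have \<psi>z: "\<psi> x * ?D x = max (?D x) 0" if "b x = 0" for x
  proof -
    have "\<psi> x * ?D x = \<theta> * (A K1 1 x * ?D x) + (1 - \<theta>) * (A 1 K2 x * ?D x)"
      by (simp add: \<psi>_def algebra_simps)
    also have "\<dots> = max (?D x) 0" unfolding Az[OF that] by (simp add: algebra_simps)
    finally show ?thesis .
  qed
  let ?G = "\<lambda>x. - (\<psi> x / a x * b x)"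
  have qC1: "(\<lambda>x. \<psi> x / a x) \<in> C1_torus"
    using \<psi>C1 a(1) apos by (intro C1_torus_divide) (auto simp: less_imp_neq[symmetric])
  show ?thesis
  proof
    show "?G \<in> C1_torus" by (intro C1_torus_minus C1_torus_mult qC1 bC1)
    have "?G = (\<lambda>x. - (\<theta> * ?F1 x + (1 - \<theta>) * ?F2 x))"
      using apos by (auto simp: \<psi>_def field_simps less_imp_neq[symmetric])
    then show "integral {0..1} ?G = 0" using mean by (simp only: integral_neg)
    show "b x * ?G x + a x * (?G x)\<^sup>2 \<le> 0" for x
    proof -
      have "b x * ?G x + a x * (?G x)\<^sup>2 = - ((b x)\<^sup>2 / a x * (\<psi> x * (1 - \<psi> x)))"
        using apos[of x] by (simp add: field_simps power2_eq_square)
      also have "\<dots> \<le> 0" using apos[of x] \<psi>01[of x] by simp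
      finally show ?thesis .
    qed
    show "- (a z * deriv ?G z) = max (?D z) 0" if "b z = 0" for z
    proof -
      have "deriv ?G z = - (deriv (\<lambda>x. \<psi> x / a x) z * b z + ?D z * (\<psi> z / a z))"
        by (intro DERIV_imp_deriv DERIV_minus DERIV_mult C1_torus_has_derivative qC1 bC1)
      then have "- (a z * deriv ?G z) = \<psi> z * ?D z"
        using that apos[of z] by (simp add: field_simps)
      then show ?thesis using \<psi>z[OF that] by simp
    qed
  qed
qed

text \<open>
  With the test field \<open>G / \<epsilon>\<close>, where \<open>G\<close> is the reversing field, the term of order \<open>1 / \<epsilon>\<close> in
  \<open>- L\<^sub>\<epsilon> u / u\<close> is nonnegative, and the remaining term \<open>- a G'\<close> is continuous and independent of \<open>\<epsilon>\<close>.
\<close>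

lemma Liminf_rate_ge_dirac:
  assumes a: "a \<in> C1_torus" "c0 > 0" "\<And>x. a x \<ge> c0" and b: "b \<in> C2_torus"
    and nd: "\<And>x. b x = 0 \<Longrightarrow> deriv b x \<noteq> 0" and fin: "finite (crit b)"
    and w: "set_pmf w \<subseteq> crit b"
    and m: "\<And>\<epsilon>. \<epsilon> > 0 \<Longrightarrow> m \<epsilon> \<in> space (prob_algebra torus)"
    and lim: "\<And>f. f \<in> C0_torus \<Longrightarrow>
      ((\<lambda>\<epsilon>. \<integral>x. f x \<partial>m \<epsilon>) \<longlongrightarrow> (\<integral>x. f x \<partial>dirac_combination (crit b) w)) (at_right 0)"
  shows "ereal (\<Sum>z\<in>crit b. pmf w z * max (deriv b z) 0)
    \<le> Liminf (at_right 0) (\<lambda>\<epsilon>. rate a b \<epsilon> (m \<epsilon>))"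
proof -
  obtain G where G: "G \<in> C1_torus" "integral {0..1} G = 0"
    and sub: "\<And>x. b x * G x + a x * (G x)\<^sup>2 \<le> 0"
    and slope: "\<And>z. b z = 0 \<Longrightarrow> - (a z * deriv G z) = max (deriv b z) 0"
    using exists_reversing_field[OF a b nd] by blast
  let ?f = "\<lambda>x. - (a x * deriv G x)"
  have C0: "a \<in> C0_torus" "b \<in> C0_torus" "G \<in> C0_torus" "deriv G \<in> C0_torus"
    using a b G C1_torus_subset_C0_torus C2_torus_subset_C1_torus deriv_C1_torus by auto
  then have f: "?f \<in> C0_torus" by auto
  have le: "ereal (\<integral>x. ?f x \<partial>m \<epsilon>) \<le> rate a b \<epsilon> (m \<epsilon>)" if \<epsilon>: "\<epsilon> > 0" for \<epsilon>
  proof -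
    let ?c = "1 / \<epsilon>"
    let ?L = "\<lambda>x. b x * (?c * G x) + \<epsilon> * a x * (?c * deriv G x + (?c * G x)\<^sup>2)"
    have L: "?L x = ?c * (b x * G x + a x * (G x)\<^sup>2) - ?f x" for x
      using \<epsilon> by (simp add: field_simps power2_eq_square)
    have "?L \<in> C0_torus"
      by (intro C0_torus_add C0_torus_mult C0_torus_power C0_torus_const C0)
    then have int: "integrable (m \<epsilon>) ?L" using C0_torus_integrable[OF m[OF \<epsilon>]] by blast
    have "(\<integral>x. ?f x \<partial>m \<epsilon>) \<le> (\<integral>x. - ?L x \<partial>m \<epsilon>)"
    proof (rule integral_mono)
      show "integrable (m \<epsilon>) ?f" by (rule C0_torus_integrable[OF m[OF \<epsilon>] f])
      show "integrable (m \<epsilon>) (\<lambda>x. - ?L x)"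
        by (rule Bochner_Integration.integrable_minus[OF int])
      show "?f x \<le> - ?L x" for x
        unfolding L using sub[of x] \<epsilon> by (simp add: divide_nonpos_pos)
    qed
    then have "(\<integral>x. ?f x \<partial>m \<epsilon>) \<le> - (\<integral>x. ?L x \<partial>m \<epsilon>)"
      by (simp only: Bochner_Integration.integral_minus)
    then have "ereal (\<integral>x. ?f x \<partial>m \<epsilon>) \<le> ereal (- (\<integral>x. ?L x \<partial>m \<epsilon>))"
      by (simp only: ereal_less_eq)
    also have "\<dots> \<le> rate a b \<epsilon> (m \<epsilon>)" by (rule rate_ge[OF G])
    finally show ?thesis .
  qed
  have "crit b \<subseteq> {0..<1}" by (auto simp: crit_def)
  then have "(\<integral>x. ?f x \<partial>dirac_combination (crit b) w) = (\<Sum>z\<in>crit b. pmf w z * ?f z)"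
    by (rule integral_dirac_combination[OF fin _ w f])
  also have "\<dots> = (\<Sum>z\<in>crit b. pmf w z * max (deriv b z) 0)"
    by (intro sum.cong refl) (simp add: slope crit_def)
  finally have "((\<lambda>\<epsilon>. \<integral>x. ?f x \<partial>m \<epsilon>) \<longlongrightarrow> (\<Sum>z\<in>crit b. pmf w z * max (deriv b z) 0)) (at_right 0)"
    using lim[OF f] by simp
  with le show ?thesis by (rule Liminf_at_right_ge)
qed

section \<open>Concentration and energy of cut-off Gibbs weights\<close>

text \<open>
  Second-order Taylor expansion at a nondegenerate maximum.
\<close>

lemma quadratic_maximum_bounds:
  fixes T h h' :: "real \<Rightarrow> real"
  assumes T: "\<And>x. (T has_real_derivative h x) (at x)"
    and h: "\<And>x. (h has_real_derivative h' x) (at x)"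
    and cont: "isCont h' z" and z: "T z = 0" "h z = 0" "h' z < 0"
  obtains \<delta> k K where "\<delta> > 0" "k > 0" "K > 0"
    "\<And>x. \<bar>x - z\<bar> \<le> \<delta> \<Longrightarrow> - K * (x - z)\<^sup>2 \<le> T x"
    "\<And>x. \<bar>x - z\<bar> \<le> \<delta> \<Longrightarrow> T x \<le> - k * (x - z)\<^sup>2"
proof -
  define c where "c = - h' z"
  have c: "c > 0" using z by (simp add: c_def)
  have "\<forall>\<^sub>F x in nhds z. \<bar>h' x - h' z\<bar> < c / 2"
  proof -
    have "((\<lambda>x. \<bar>h' x - h' z\<bar>) \<longlongrightarrow> \<bar>h' z - h' z\<bar>) (nhds z)"
      using cont by (intro tendsto_intros) (simp add: isCont_def tendsto_at_iff_tendsto_nhds)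
    then show ?thesis using c by (intro order_tendstoD) auto
  qed
  then obtain d where d: "d > 0" "\<And>x. dist x z < d \<Longrightarrow> \<bar>h' x - h' z\<bar> < c / 2"
    unfolding eventually_nhds_metric by blast
  have bounds: "- c * (x - z)\<^sup>2 \<le> T x \<and> T x \<le> - (c / 4) * (x - z)\<^sup>2" if x: "\<bar>x - z\<bar> \<le> d / 2" for x
  proof (cases "x = z")
    case False
    define D where "D m = (if m = 0 then T else if m = 1 then h else h')" for m :: nat
    have "\<exists>t. (if x < z then x < t \<and> t < z else z < t \<and> t < x) \<and>
        T x = (\<Sum>m<2. D m z / fact m * (x - z) ^ m) + D 2 t / fact 2 * (x - z) ^ 2"
      using False T h
      by (intro Taylor[where a = "min x z" and b = "max x z"]) (auto simp: D_def less_Suc_eq numeral_2_eq_2)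
    then obtain t where t: "if x < z then x < t \<and> t < z else z < t \<and> t < x"
      and Tx: "T x = h' t / 2 * (x - z)\<^sup>2"
      by (auto simp: D_def z numeral_2_eq_2)
    have "dist t z < d" using t x d(1) by (auto simp: dist_real_def split: if_splits)
    from d(2)[OF this] have "- c \<le> h' t / 2" "h' t / 2 \<le> - (c / 4)"
      using c unfolding c_def by (auto simp: abs_less_iff)
    then show ?thesis unfolding Tx by (intro conjI mult_right_mono) auto
  qed (simp add: z)
  show ?thesis
    by (rule that[of "d / 2" "c / 4" c]) (use d c bounds in auto)
qed

lemma mult_exp_minus_le:
  fixes s k \<epsilon> :: real
  assumes "k > 0" "\<epsilon> > 0"
  shows "s * exp (- k * s / \<epsilon>) \<le> \<epsilon> / k"
proof -
  have "k * s / \<epsilon> \<le> exp (k * s / \<epsilon>)"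
    using exp_ge_add_one_self[of "k * s / \<epsilon>"] by linarith
  then have "s \<le> \<epsilon> / k * exp (k * s / \<epsilon>)"
    using assms by (simp add: field_simps)
  then show ?thesis
    by (simp add: exp_minus field_simps)
qed

text \<open>
  The error terms below consist of a modulus of continuity \<open>\<eta>\<close> and of moments of order \<open>sqrt \<epsilon>\<close>
  with constants that depend on \<open>\<eta>\<close>.
\<close>

lemma tendsto_at_right_sqrt_bound:
  fixes F :: "real \<Rightarrow> real"
  assumes "\<And>\<eta>. \<eta> > 0 \<Longrightarrow> \<exists>C \<epsilon>0. \<epsilon>0 > 0 \<and> (\<forall>\<epsilon>. 0 < \<epsilon> \<longrightarrow> \<epsilon> \<le> \<epsilon>0 \<longrightarrow> \<bar>F \<epsilon> - L\<bar> \<le> \<eta> + C * sqrt \<epsilon>)"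
  shows "(F \<longlongrightarrow> L) (at_right 0)"
proof (rule tendstoI)
  fix e :: real assume e: "e > 0"
  obtain C \<epsilon>0 where C: "\<epsilon>0 > 0" "\<And>\<epsilon>. 0 < \<epsilon> \<Longrightarrow> \<epsilon> \<le> \<epsilon>0 \<Longrightarrow> \<bar>F \<epsilon> - L\<bar> \<le> e / 2 + C * sqrt \<epsilon>"
    using assms[of "e / 2"] e by auto
  have "((\<lambda>\<epsilon>. e / 2 + C * sqrt \<epsilon>) \<longlongrightarrow> e / 2 + C * sqrt 0) (at_right 0)"
    by (intro tendsto_intros)
  from order_tendstoD(2)[OF this, of e] e
  have "\<forall>\<^sub>F \<epsilon> in at_right 0. e / 2 + C * sqrt \<epsilon> < e" by simp
  moreover have "\<forall>\<^sub>F \<epsilon> in at_right 0. \<epsilon> < \<epsilon>0"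
    using C(1) by (intro order_tendstoD(2)[OF tendsto_ident_at]) auto
  moreover have "\<forall>\<^sub>F \<epsilon> in at_right (0::real). \<epsilon> > 0"
    by (simp add: eventually_at_right_less)
  ultimately show "\<forall>\<^sub>F \<epsilon> in at_right 0. dist (F \<epsilon>) L < e"
  proof eventually_elim
    case (elim \<epsilon>)
    then show ?case using C(2)[of \<epsilon>] by (simp add: dist_real_def)
  qed
qed

text \<open>
  A crude form of Laplace's method for the weight \<open>exp (T / \<epsilon>) q\<^sup>2 / a\<close> with the cut-off
  \<open>q x = \<delta>\<^sup>2 - (x - z)\<^sup>2\<close>.  The window of width \<open>sqrt \<epsilon>\<close> around the maximum shows that the total mass
  is at least of order \<open>sqrt \<epsilon>\<close>, while both the unnormalised second moment and \<open>\<epsilon> \<integral> exp (T / \<epsilon>) q'\<^sup>2\<close>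
  are of order \<open>\<epsilon>\<close>.  The cut-off is a polynomial on the interval, since it enters the later integration
  by parts only through its vanishing at the end points.
\<close>

lemma peak_estimates:
  fixes T h h' :: "real \<Rightarrow> real"
  assumes T: "\<And>x. (T has_real_derivative h x) (at x)"
    and h: "\<And>x. (h has_real_derivative h' x) (at x)"
    and cont: "isCont h' z" and z: "T z = 0" "h z = 0" "h' z < 0"
    and a: "a \<in> C0_torus" "c0 > 0" "\<And>x. a x \<ge> c0"
  obtains \<delta> where "\<delta> > 0"
    "\<And>\<epsilon>. \<epsilon> > 0 \<Longrightarrow> integral {z - \<delta>..z + \<delta>} (\<lambda>x. exp (T x / \<epsilon>) * (\<delta>\<^sup>2 - (x - z)\<^sup>2)\<^sup>2 / a x) > 0"
    "\<And>f. f \<in> C0_torus \<Longrightarrow>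
      ((\<lambda>\<epsilon>. integral {z - \<delta>..z + \<delta>} (\<lambda>x. f x * (exp (T x / \<epsilon>) * (\<delta>\<^sup>2 - (x - z)\<^sup>2)\<^sup>2 / a x)) /
        integral {z - \<delta>..z + \<delta>} (\<lambda>x. exp (T x / \<epsilon>) * (\<delta>\<^sup>2 - (x - z)\<^sup>2)\<^sup>2 / a x)) \<longlongrightarrow> f z) (at_right 0)"
    "((\<lambda>\<epsilon>. \<epsilon> * integral {z - \<delta>..z + \<delta>} (\<lambda>x. exp (T x / \<epsilon>) * (2 * (x - z))\<^sup>2) /
        integral {z - \<delta>..z + \<delta>} (\<lambda>x. exp (T x / \<epsilon>) * (\<delta>\<^sup>2 - (x - z)\<^sup>2)\<^sup>2 / a x)) \<longlongrightarrow> 0) (at_right 0)"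
proof -
  obtain \<delta> k K where \<delta>: "\<delta> > 0" and k: "k > 0" and K: "K > 0"
    and lower: "\<And>x. \<bar>x - z\<bar> \<le> \<delta> \<Longrightarrow> - K * (x - z)\<^sup>2 \<le> T x"
    and upper: "\<And>x. \<bar>x - z\<bar> \<le> \<delta> \<Longrightarrow> T x \<le> - k * (x - z)\<^sup>2"
    using quadratic_maximum_bounds[OF T h cont z] by blast
  obtain A where A: "A > 0" "\<And>x. \<bar>a x\<bar> \<le> A" using C0_torus_bounded[OF a(1)] by blast
  have apos: "a x > 0" for x using a(2) a(3)[of x] by linarith
  have ale: "a x \<le> A" for x using A(2)[of x] by linarith
  let ?I = "{z - \<delta>..z + \<delta>}"
  define W where "W \<epsilon> x = exp (T x / \<epsilon>) * (\<delta>\<^sup>2 - (x - z)\<^sup>2)\<^sup>2 / a x" for \<epsilon> x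
  define Z where "Z \<epsilon> = integral ?I (W \<epsilon>)" for \<epsilon>
  have contT: "continuous_on S T" for S
    using T by (meson DERIV_isCont continuous_at_imp_continuous_on)
  have conta: "continuous_on S a" for S
    using a(1) by (auto simp: C0_torus_def intro: continuous_on_subset)
  have contW: "continuous_on S (W \<epsilon>)" if "\<epsilon> > 0" for S \<epsilon>
    unfolding W_def[abs_def] using that apos
    by (intro continuous_intros contT conta) (auto simp: less_imp_neq[symmetric])
  have Wint: "(\<lambda>x. f x * W \<epsilon> x) integrable_on {l..r}" if "continuous_on UNIV f" "\<epsilon> > 0" for f \<epsilon> l r
    using that by (intro integrable_continuous_interval continuous_intros contW)
      (auto intro: continuous_on_subset)
  have Wint1: "W \<epsilon> integrable_on {l..r}" if "\<epsilon> > 0" for \<epsilon> l r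
    using that by (intro integrable_continuous_interval contW)
  have W0: "W \<epsilon> x \<ge> 0" for \<epsilon> x unfolding W_def using apos[of x] by simp
  \<comment> \<open>For \<open>sqrt \<epsilon> \<le> \<delta> / 2\<close> the constant \<open>c / 2\<close> is a lower bound of \<open>W \<epsilon>\<close> on the window
    \<open>\<bar>x - z\<bar> \<le> sqrt \<epsilon>\<close>: there \<open>T \<ge> - K \<epsilon>\<close> and the cut-off is at least \<open>3/4 \<delta>\<^sup>2\<close>.\<close>
  define c where "c = 2 * (exp (- K) * (3 / 4 * \<delta>\<^sup>2)\<^sup>2 / A)"
  have c: "c > 0" using \<delta> A(1) by (simp add: c_def)
  have Z_lower: "c * sqrt \<epsilon> \<le> Z \<epsilon>" if \<epsilon>: "0 < \<epsilon>" "\<epsilon> \<le> (\<delta> / 2)\<^sup>2" for \<epsilon>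
  proof -
    have s: "0 < sqrt \<epsilon>" using \<epsilon> by simp
    have s2: "sqrt \<epsilon> \<le> \<delta> / 2" using \<epsilon> \<delta> by (intro real_le_lsqrt) auto
    have "c * sqrt \<epsilon> = integral {z - sqrt \<epsilon>..z + sqrt \<epsilon>} (\<lambda>_. c / 2)"
      using s by simp
    also have "\<dots> \<le> integral {z - sqrt \<epsilon>..z + sqrt \<epsilon>} (W \<epsilon>)"
    proof (rule integral_le)
      fix x assume "x \<in> {z - sqrt \<epsilon>..z + sqrt \<epsilon>}"
      then have x: "\<bar>x - z\<bar> \<le> sqrt \<epsilon>" by auto
      then have x2: "(x - z)\<^sup>2 \<le> \<epsilon>"
        using \<epsilon> power_mono[of "\<bar>x - z\<bar>" "sqrt \<epsilon>" 2] by simp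
      have "- K * \<epsilon> \<le> - K * (x - z)\<^sup>2" using x2 K by simp
      also have "\<dots> \<le> T x" using lower[of x] x s2 \<delta> by simp
      finally have e: "exp (- K) \<le> exp (T x / \<epsilon>)" using \<epsilon> by (simp add: field_simps)
      have "3 / 4 * \<delta>\<^sup>2 \<le> \<delta>\<^sup>2 - (x - z)\<^sup>2" using x2 \<epsilon>(2) by (simp add: power_divide)
      then have q: "(3 / 4 * \<delta>\<^sup>2)\<^sup>2 \<le> (\<delta>\<^sup>2 - (x - z)\<^sup>2)\<^sup>2" by (intro power_mono) auto
      have "c / 2 = exp (- K) * (3 / 4 * \<delta>\<^sup>2)\<^sup>2 / A" by (simp add: c_def)
      also have "\<dots> \<le> W \<epsilon> x"
        unfolding W_def using e q ale[of x] apos[of x] by (intro frac_le mult_mono) auto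
      finally show "c / 2 \<le> W \<epsilon> x" .
    qed (use Wint1 \<epsilon> in auto)
    also have "\<dots> \<le> Z \<epsilon>"
      unfolding Z_def using s2 \<delta> \<epsilon> W0 by (intro integral_subset_le Wint1) auto
    finally show ?thesis .
  qed
  have Zpos: "Z \<epsilon> > 0" if \<epsilon>: "\<epsilon> > 0" for \<epsilon>
  proof -
    have "Z \<epsilon> \<noteq> 0"
    proof
      assume "Z \<epsilon> = 0"
      then have "\<forall>x\<in>cbox (z - \<delta>) (z + \<delta>). W \<epsilon> x = 0"
        using integral_cbox_eq_0_iff[of "z - \<delta>" "z + \<delta>" "W \<epsilon>"] contW[OF \<epsilon>] W0 \<delta> by (simp add: Z_def)
      moreover have "z \<in> cbox (z - \<delta>) (z + \<delta>)" using \<delta> by simp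
      ultimately have "W \<epsilon> z = 0" by blast
      then show False using \<delta> apos[of z] by (simp add: W_def)
    qed
    moreover have "Z \<epsilon> \<ge> 0" unfolding Z_def using W0 Wint1[OF \<epsilon>] by (intro integral_nonneg) auto
    ultimately show ?thesis by simp
  qed
  have eps0: "(\<delta> / 2)\<^sup>2 > 0" using \<delta> by simp
  have ratio: "y * \<epsilon> / Z \<epsilon> \<le> y / c * sqrt \<epsilon>" if "0 < \<epsilon>" "\<epsilon> \<le> (\<delta> / 2)\<^sup>2" "y \<ge> 0" for y \<epsilon>
  proof -
    have "y * \<epsilon> / Z \<epsilon> \<le> y * \<epsilon> / (c * sqrt \<epsilon>)"
      using Z_lower[OF that(1,2)] that c by (intro divide_left_mono mult_pos_pos Zpos) auto
    also have "\<dots> = y / c * sqrt \<epsilon>"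
      using that c by (simp add: field_simps)
    finally show ?thesis .
  qed
  define M where "M = 2 * \<delta> * (1 / k * (\<delta>\<^sup>2)\<^sup>2 / c0)"
  have M: "M \<ge> 0" using \<delta> k a(2) by (simp add: M_def)
  \<comment> \<open>The Gaussian bound on \<open>exp (T / \<epsilon>)\<close> trades the factor \<open>(x - z)\<^sup>2\<close> for a factor \<open>\<epsilon> / k\<close>.\<close>
  have moment: "integral ?I (\<lambda>x. (x - z)\<^sup>2 * W \<epsilon> x) \<le> M * \<epsilon>" if \<epsilon>: "\<epsilon> > 0" for \<epsilon>
  proof -
    have "integral ?I (\<lambda>x. (x - z)\<^sup>2 * W \<epsilon> x) \<le> integral ?I (\<lambda>x. \<epsilon> / k * (\<delta>\<^sup>2)\<^sup>2 / c0)"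
    proof (rule integral_le)
      show "(\<lambda>x. (x - z)\<^sup>2 * W \<epsilon> x) integrable_on ?I"
        by (intro Wint \<epsilon> continuous_intros)
      fix x assume "x \<in> ?I"
      then have x: "\<bar>x - z\<bar> \<le> \<delta>" by auto
      have "(x - z)\<^sup>2 * exp (T x / \<epsilon>) \<le> (x - z)\<^sup>2 * exp (- k * (x - z)\<^sup>2 / \<epsilon>)"
        using divide_right_mono[OF upper[OF x], of \<epsilon>] \<epsilon>
        by (intro mult_left_mono) (simp_all only: exp_le_cancel_iff zero_le_power2 less_imp_le)
      also have "\<dots> \<le> \<epsilon> / k" by (rule mult_exp_minus_le[OF k \<epsilon>])
      finally have 1: "(x - z)\<^sup>2 * exp (T x / \<epsilon>) \<le> \<epsilon> / k" .
      have "(x - z)\<^sup>2 \<le> \<delta>\<^sup>2" using x by (simp add: abs_le_square_iff[symmetric])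
      then have 2: "(\<delta>\<^sup>2 - (x - z)\<^sup>2)\<^sup>2 \<le> (\<delta>\<^sup>2)\<^sup>2" by (intro power_mono) auto
      have "(x - z)\<^sup>2 * W \<epsilon> x = (x - z)\<^sup>2 * exp (T x / \<epsilon>) * (\<delta>\<^sup>2 - (x - z)\<^sup>2)\<^sup>2 / a x"
        by (simp add: W_def)
      also have "\<dots> \<le> \<epsilon> / k * (\<delta>\<^sup>2)\<^sup>2 / c0"
        using 1 2 a(2) a(3)[of x] \<epsilon> k by (intro frac_le mult_mono) auto
      finally show "(x - z)\<^sup>2 * W \<epsilon> x \<le> \<epsilon> / k * (\<delta>\<^sup>2)\<^sup>2 / c0" .
    qed auto
    also have "\<dots> = M * \<epsilon>" using \<delta> by (simp add: M_def)
    finally show ?thesis .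
  qed
  have conv: "((\<lambda>\<epsilon>. integral ?I (\<lambda>x. f x * W \<epsilon> x) / Z \<epsilon>) \<longlongrightarrow> f z) (at_right 0)"
    if f: "f \<in> C0_torus" for f
  proof (rule tendsto_at_right_sqrt_bound)
    fix \<eta> :: real assume \<eta>: "\<eta> > 0"
    have contf: "continuous_on UNIV f" using f by (simp add: C0_torus_def)
    obtain B where B: "B > 0" "\<And>x. \<bar>f x\<bar> \<le> B" using C0_torus_bounded[OF f] by blast
    obtain r where r: "r > 0" "\<And>x. \<bar>x - z\<bar> < r \<Longrightarrow> \<bar>f x - f z\<bar> < \<eta>"
      using contf \<eta> unfolding continuous_on_iff dist_real_def by (metis UNIV_I)
    let ?C = "2 * B / r\<^sup>2"
    have dev: "\<bar>f x - f z\<bar> \<le> \<eta> + ?C * (x - z)\<^sup>2" for x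
    proof (cases "\<bar>x - z\<bar> < r")
      case True
      moreover have "?C * (x - z)\<^sup>2 \<ge> 0" using B(1) by simp
      ultimately show ?thesis using r(2)[of x] by linarith
    next
      case False
      then have "r\<^sup>2 \<le> (x - z)\<^sup>2" using r(1) by (simp add: abs_le_square_iff[symmetric])
      then have "2 * B \<le> ?C * (x - z)\<^sup>2" using B(1) r(1) by (simp add: field_simps)
      moreover have "\<bar>f x - f z\<bar> \<le> 2 * B" using B(2)[of x] B(2)[of z] by linarith
      ultimately show ?thesis using \<eta> by linarith
    qed
    have "\<bar>integral ?I (\<lambda>x. f x * W \<epsilon> x) / Z \<epsilon> - f z\<bar> \<le> \<eta> + ?C * M / c * sqrt \<epsilon>"
      if \<epsilon>: "0 < \<epsilon>" "\<epsilon> \<le> (\<delta> / 2)\<^sup>2" for \<epsilon>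
    proof -
      note Zp = Zpos[OF \<epsilon>(1)]
      have "integral ?I (\<lambda>x. f x * W \<epsilon> x) - f z * Z \<epsilon>
          = integral ?I (\<lambda>x. f x * W \<epsilon> x) - integral ?I (\<lambda>x. f z * W \<epsilon> x)"
        by (simp add: Z_def)
      also have "\<dots> = integral ?I (\<lambda>x. f x * W \<epsilon> x - f z * W \<epsilon> x)"
        by (intro integral_diff[symmetric] Wint contf continuous_on_const \<epsilon>)
      finally have "integral ?I (\<lambda>x. f x * W \<epsilon> x) - f z * Z \<epsilon>
          = integral ?I (\<lambda>x. (f x - f z) * W \<epsilon> x)" by (simp add: algebra_simps)
      moreover have "\<bar>integral ?I (\<lambda>x. (f x - f z) * W \<epsilon> x)\<bar>
          \<le> integral ?I (\<lambda>x. \<eta> * W \<epsilon> x + ?C * ((x - z)\<^sup>2 * W \<epsilon> x))"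
      proof -
        have "norm (integral ?I (\<lambda>x. (f x - f z) * W \<epsilon> x))
            \<le> integral ?I (\<lambda>x. \<eta> * W \<epsilon> x + ?C * ((x - z)\<^sup>2 * W \<epsilon> x))"
        proof (rule integral_norm_bound_integral)
          show "(\<lambda>x. (f x - f z) * W \<epsilon> x) integrable_on ?I"
            by (intro Wint \<epsilon> continuous_intros contf)
          show "(\<lambda>x. \<eta> * W \<epsilon> x + ?C * ((x - z)\<^sup>2 * W \<epsilon> x)) integrable_on ?I"
            by (intro integrable_add integrable_on_mult_right Wint Wint1 \<epsilon> continuous_intros)
          fix x
          have "norm ((f x - f z) * W \<epsilon> x) = \<bar>f x - f z\<bar> * W \<epsilon> x"
            using W0[of \<epsilon> x] by (simp add: abs_mult)
          also have "\<dots> \<le> (\<eta> + ?C * (x - z)\<^sup>2) * W \<epsilon> x"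
            by (rule mult_right_mono[OF dev W0])
          also have "\<dots> = \<eta> * W \<epsilon> x + ?C * ((x - z)\<^sup>2 * W \<epsilon> x)"
            by (simp only: distrib_right mult.assoc)
          finally show "norm ((f x - f z) * W \<epsilon> x) \<le> \<eta> * W \<epsilon> x + ?C * ((x - z)\<^sup>2 * W \<epsilon> x)" .
        qed
        then show ?thesis by simp
      qed
      moreover have "integral ?I (\<lambda>x. \<eta> * W \<epsilon> x + ?C * ((x - z)\<^sup>2 * W \<epsilon> x))
          = \<eta> * Z \<epsilon> + ?C * integral ?I (\<lambda>x. (x - z)\<^sup>2 * W \<epsilon> x)"
        unfolding Z_def integral_mult_right[symmetric]
        by (intro integral_add integrable_on_mult_right Wint Wint1 \<epsilon> continuous_intros)
      moreover have "?C * integral ?I (\<lambda>x. (x - z)\<^sup>2 * W \<epsilon> x) \<le> ?C * (M * \<epsilon>)"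
        using B(1) by (intro mult_left_mono moment \<epsilon>) auto
      ultimately have "\<bar>integral ?I (\<lambda>x. f x * W \<epsilon> x) - f z * Z \<epsilon>\<bar> \<le> \<eta> * Z \<epsilon> + ?C * (M * \<epsilon>)"
        by linarith
      then have "\<bar>integral ?I (\<lambda>x. f x * W \<epsilon> x) - f z * Z \<epsilon>\<bar> / Z \<epsilon> \<le> (\<eta> * Z \<epsilon> + ?C * (M * \<epsilon>)) / Z \<epsilon>"
        using Zp by (intro divide_right_mono) auto
      moreover have "\<bar>integral ?I (\<lambda>x. f x * W \<epsilon> x) - f z * Z \<epsilon>\<bar> / Z \<epsilon>
          = \<bar>integral ?I (\<lambda>x. f x * W \<epsilon> x) / Z \<epsilon> - f z\<bar>"
        using Zp by (simp add: diff_divide_distrib abs_div_pos)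
      moreover have "(\<eta> * Z \<epsilon> + ?C * (M * \<epsilon>)) / Z \<epsilon> = \<eta> + ?C * M * \<epsilon> / Z \<epsilon>"
        using Zp by (simp add: add_divide_distrib)
      moreover have "?C * M * \<epsilon> / Z \<epsilon> \<le> ?C * M / c * sqrt \<epsilon>"
        using B(1) M by (intro ratio \<epsilon>) auto
      ultimately show ?thesis by linarith
    qed
    then show "\<exists>C \<epsilon>0. \<epsilon>0 > 0 \<and> (\<forall>\<epsilon>. 0 < \<epsilon> \<longrightarrow> \<epsilon> \<le> \<epsilon>0 \<longrightarrow>
        \<bar>integral ?I (\<lambda>x. f x * W \<epsilon> x) / Z \<epsilon> - f z\<bar> \<le> \<eta> + C * sqrt \<epsilon>)"
      using eps0 by blast
  qed
  have cost: "((\<lambda>\<epsilon>. \<epsilon> * integral ?I (\<lambda>x. exp (T x / \<epsilon>) * (2 * (x - z))\<^sup>2) / Z \<epsilon>) \<longlongrightarrow> 0) (at_right 0)"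
  proof (rule tendsto_at_right_sqrt_bound)
    fix \<eta> :: real assume \<eta>: "\<eta> > 0"
    let ?y = "2 * \<delta> * (2 * \<delta>)\<^sup>2"
    have "\<bar>\<epsilon> * integral ?I (\<lambda>x. exp (T x / \<epsilon>) * (2 * (x - z))\<^sup>2) / Z \<epsilon> - 0\<bar> \<le> \<eta> + ?y / c * sqrt \<epsilon>"
      if \<epsilon>: "0 < \<epsilon>" "\<epsilon> \<le> (\<delta> / 2)\<^sup>2" for \<epsilon>
    proof -
      let ?J = "integral ?I (\<lambda>x. exp (T x / \<epsilon>) * (2 * (x - z))\<^sup>2)"
      have int: "(\<lambda>x. exp (T x / \<epsilon>) * (2 * (x - z))\<^sup>2) integrable_on ?I"
        using \<epsilon> by (intro integrable_continuous_interval continuous_intros contT) auto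
      have "?J \<le> integral ?I (\<lambda>_. (2 * \<delta>)\<^sup>2)"
      proof (rule integral_le[OF int])
        fix x assume "x \<in> ?I"
        then have x: "\<bar>x - z\<bar> \<le> \<delta>" by auto
        have "T x \<le> 0" using upper[OF x] k
          by (smt (verit) mult_minus_left mult_nonneg_nonneg zero_le_power2)
        then have "exp (T x / \<epsilon>) \<le> 1" using \<epsilon> by (simp add: divide_nonpos_pos)
        moreover have "\<bar>2 * (x - z)\<bar> \<le> \<bar>2 * \<delta>\<bar>"
          unfolding abs_mult using x \<delta> by simp
        then have "(2 * (x - z))\<^sup>2 \<le> (2 * \<delta>)\<^sup>2" by (simp only: abs_le_square_iff)
        ultimately show "exp (T x / \<epsilon>) * (2 * (x - z))\<^sup>2 \<le> (2 * \<delta>)\<^sup>2"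
          using mult_mono[of "exp (T x / \<epsilon>)" 1 "(2 * (x - z))\<^sup>2" "(2 * \<delta>)\<^sup>2"] by simp
      qed auto
      then have J: "?J \<le> ?y" using \<delta> by simp
      have J0: "?J \<ge> 0" by (intro integral_nonneg int) auto
      have "\<epsilon> * ?J / Z \<epsilon> \<le> ?y * \<epsilon> / Z \<epsilon>"
        using J \<epsilon> Zpos[OF \<epsilon>(1)] by (intro divide_right_mono) (auto simp: mult.commute)
      also have "\<dots> \<le> ?y / c * sqrt \<epsilon>" using \<delta> by (intro ratio \<epsilon>) auto
      finally have "\<epsilon> * ?J / Z \<epsilon> \<le> ?y / c * sqrt \<epsilon>" .
      moreover have "\<epsilon> * ?J / Z \<epsilon> \<ge> 0" using J0 \<epsilon> Zpos[OF \<epsilon>(1)] by simp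
      ultimately show ?thesis using \<eta> by simp
    qed
    then show "\<exists>C \<epsilon>0. \<epsilon>0 > 0 \<and> (\<forall>\<epsilon>. 0 < \<epsilon> \<longrightarrow> \<epsilon> \<le> \<epsilon>0 \<longrightarrow>
        \<bar>\<epsilon> * integral ?I (\<lambda>x. exp (T x / \<epsilon>) * (2 * (x - z))\<^sup>2) / Z \<epsilon> - 0\<bar> \<le> \<eta> + C * sqrt \<epsilon>)"
      using eps0 by blast
  qed
  show ?thesis
    by (rule that[OF \<delta>]) (use Zpos conv cost in \<open>auto simp: Z_def W_def[abs_def]\<close>)
qed

text \<open>
  Up to the derivative of \<open>\<epsilon> exp (T / \<epsilon>) G q\<^sup>2\<close>, which integrates to zero because \<open>q\<close> vanishes at the end
  points, the integrand is \<open>\<epsilon> exp (T / \<epsilon>) ((G q - q')\<^sup>2 - q'\<^sup>2)\<close>.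
\<close>

lemma weighted_energy_lower_bound:
  fixes G G' T h q q' :: "real \<Rightarrow> real"
  assumes G: "\<And>x. (G has_real_derivative G' x) (at x)" "continuous_on UNIV G'"
    and T: "\<And>x. (T has_real_derivative h x) (at x)" "continuous_on UNIV h"
    and q: "\<And>x. (q has_real_derivative q' x) (at x)" "continuous_on UNIV q'"
    and ends: "q l = 0" "q r = 0" "l \<le> r" and \<epsilon>: "\<epsilon> > 0"
  shows "- (\<epsilon> * integral {l..r} (\<lambda>x. exp (T x / \<epsilon>) * (q' x)\<^sup>2))
    \<le> integral {l..r} (\<lambda>x. (h x * G x + \<epsilon> * (G' x + (G x)\<^sup>2)) * (exp (T x / \<epsilon>) * (q x)\<^sup>2))"
proof -
  have cont: "continuous_on S G" "continuous_on S T" "continuous_on S q"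
    "continuous_on S G'" "continuous_on S h" "continuous_on S q'" for S
    using G T q by (meson DERIV_isCont continuous_at_imp_continuous_on continuous_on_subset subset_UNIV)+
  let ?E = "\<lambda>x. exp (T x / \<epsilon>)"
  let ?F = "\<lambda>x. \<epsilon> * (?E x * (G x * (q x)\<^sup>2))"
  let ?F' = "\<lambda>x. ?E x * (h x * G x * (q x)\<^sup>2 + \<epsilon> * G' x * (q x)\<^sup>2 + 2 * \<epsilon> * G x * q x * q' x)"
  have dF: "(?F has_real_derivative ?F' x) (at x)" for x
    using \<epsilon> by (auto intro!: derivative_eq_intros G T q simp: field_simps power2_eq_square)
  have "(?F' has_integral ?F r - ?F l) {l..r}"
  proof (rule fundamental_theorem_of_calculus[OF ends(3)])
    fix x
    show "(?F has_vector_derivative ?F' x) (at x within {l..r})"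
      using has_field_derivative_at_within[OF dF]
      by (simp only: has_real_derivative_iff_has_vector_derivative)
  qed
  then have F0: "(?F' has_integral 0) {l..r}" by (simp add: ends)
  have intE: "(\<lambda>x. ?E x * (q' x)\<^sup>2) integrable_on {l..r}"
    using \<epsilon> by (intro integrable_continuous_interval continuous_intros cont) auto
  have "((\<lambda>x. ?F' x - \<epsilon> * (?E x * (q' x)\<^sup>2)) has_integral
      (0 - \<epsilon> * integral {l..r} (\<lambda>x. ?E x * (q' x)\<^sup>2))) {l..r}"
    by (intro has_integral_diff F0 has_integral_mult_right integrable_integral intE)
  moreover have "((\<lambda>x. (h x * G x + \<epsilon> * (G' x + (G x)\<^sup>2)) * (?E x * (q x)\<^sup>2)) has_integral
      integral {l..r} (\<lambda>x. (h x * G x + \<epsilon> * (G' x + (G x)\<^sup>2)) * (?E x * (q x)\<^sup>2))) {l..r}"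
    using \<epsilon> by (intro integrable_integral integrable_continuous_interval continuous_intros cont) auto
  moreover have "?F' x - \<epsilon> * (?E x * (q' x)\<^sup>2)
      \<le> (h x * G x + \<epsilon> * (G' x + (G x)\<^sup>2)) * (?E x * (q x)\<^sup>2)" for x
  proof -
    have "(h x * G x + \<epsilon> * (G' x + (G x)\<^sup>2)) * (?E x * (q x)\<^sup>2) - (?F' x - \<epsilon> * (?E x * (q' x)\<^sup>2))
        = \<epsilon> * (?E x * (G x * q x - q' x)\<^sup>2)"
      by (simp add: algebra_simps power2_eq_square)
    also have "\<dots> \<ge> 0" using \<epsilon> by simp
    finally show ?thesis by linarith
  qed
  ultimately have "0 - \<epsilon> * integral {l..r} (\<lambda>x. ?E x * (q' x)\<^sup>2)
      \<le> integral {l..r} (\<lambda>x. (h x * G x + \<epsilon> * (G' x + (G x)\<^sup>2)) * (?E x * (q x)\<^sup>2))"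
    by (rule has_integral_le)
  then show ?thesis by simp
qed

section \<open>Recovery families\<close>

text \<open>
  Probability densities on the line that concentrate at \<open>z\<close>, together with a bound \<open>r\<close> for their rates
  that is asymptotically optimal.  The bound is stated for each test function separately, since in this
  form it is linear in the density and passes to mixtures.
\<close>

definition peaked_at ::
  "(real \<Rightarrow> real) \<Rightarrow> (real \<Rightarrow> real) \<Rightarrow> real \<Rightarrow> (real \<Rightarrow> real \<Rightarrow> real) \<Rightarrow> (real \<Rightarrow> real) \<Rightarrow> bool" where
  "peaked_at a b z \<rho> r \<longleftrightarrow>
    (\<forall>\<epsilon>>0. (\<forall>x. \<rho> \<epsilon> x \<ge> 0) \<and> integrable lborel (\<rho> \<epsilon>) \<and> (\<integral>x. \<rho> \<epsilon> x \<partial>lborel) = 1) \<and>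
    (\<forall>f\<in>C0_torus. ((\<lambda>\<epsilon>. \<integral>x. f x * \<rho> \<epsilon> x \<partial>lborel) \<longlongrightarrow> f z) (at_right 0)) \<and>
    (\<forall>\<epsilon>>0. \<forall>u\<in>C2_torus. (\<forall>x. u x > 0) \<longrightarrow>
      - (\<integral>x. generator a b \<epsilon> u x / u x * \<rho> \<epsilon> x \<partial>lborel) \<le> r \<epsilon>) \<and>
    (r \<longlongrightarrow> max (deriv b z) 0) (at_right 0)"

text \<open>
  The sign \<open>\<tau>\<close> is chosen so that the primitive \<open>T\<close> of \<open>\<tau> b / a\<close> has a maximum at \<open>z\<close>.  For a stable zero
  \<open>\<tau> = 1\<close> and the energy bound applies to \<open>u' / u\<close> as it stands.  For an unstable zero \<open>\<tau> = - 1\<close>,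
  and it applies to \<open>u' / u + b / (\<epsilon> a)\<close>; the shift costs \<open>a (b / a)'\<close>.  The factor \<open>\<kappa>\<close> is 0 in the
  first case and 1 in the second.
\<close>

lemma exists_peaked_at:
  assumes a: "a \<in> C1_torus" "c0 > 0" "\<And>x. a x \<ge> c0" and b: "b \<in> C2_torus"
    and z: "b z = 0" "deriv b z \<noteq> 0"
  shows "\<exists>\<rho> r. peaked_at a b z \<rho> r"
proof -
  have apos: "a x > 0" for x using a(2) a(3)[of x] by linarith
  have anz: "a x \<noteq> 0" for x using apos[of x] by simp
  have C1: "b \<in> C1_torus" using b C2_torus_subset_C1_torus by blast
  have a0: "a \<in> C0_torus" using a(1) C1_torus_subset_C0_torus by blast
  define g where "g x = b x / a x" for x
  have gC1: "g \<in> C1_torus" unfolding g_def[abs_def] by (intro C1_torus_divide C1 a(1) anz)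
  note dg = C1_torus_has_derivative[OF gC1]
  have gz: "g z = 0" by (simp add: g_def z)
  have "(g has_real_derivative (deriv b z * a z - b z * deriv a z) / (a z * a z)) (at z)"
    unfolding g_def[abs_def] by (intro DERIV_divide C1_torus_has_derivative C1 a(1) anz)
  then have "deriv g z = (deriv b z * a z - b z * deriv a z) / (a z * a z)" by (rule DERIV_imp_deriv)
  then have dgz: "a z * deriv g z = deriv b z" using anz[of z] z(1) by simp
  define \<tau> where "\<tau> = (if deriv b z < 0 then 1 else - 1 :: real)"
  define \<kappa> where "\<kappa> = (if deriv b z < 0 then 0 else 1 :: real)"
  have contg: "continuous_on UNIV g" "continuous_on UNIV (deriv g)"
    using gC1 C1_torus_subset_C0_torus deriv_C1_torus by (auto simp: C0_torus_def)
  obtain T0 where T0: "\<And>x. (T0 has_real_derivative \<tau> * g x) (at x)"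
    using exists_antiderivative[of "\<lambda>x. \<tau> * g x"] contg continuous_on_mult_left by blast
  define T where "T x = T0 x - T0 z" for x
  have T: "(T has_real_derivative \<tau> * g x) (at x)" for x
    unfolding T_def[abs_def] using DERIV_diff[OF T0 DERIV_const] by simp
  have dh: "((\<lambda>x. \<tau> * g x) has_real_derivative \<tau> * deriv g x) (at x)" for x
    by (intro DERIV_cmult dg)
  have h'z: "\<tau> * deriv g z < 0"
  proof -
    have "a z * (\<tau> * deriv g z) < 0"
      using dgz z(2) by (auto simp: \<tau>_def)
    then show ?thesis using apos[of z] by (simp add: mult_less_0_iff)
  qed
  have iso: "isCont (\<lambda>x. \<tau> * deriv g x) z"
    using contg(2) by (intro continuous_intros) (simp add: continuous_on_eq_continuous_at)
  let ?W = "\<lambda>\<delta> \<epsilon> x. exp (T x / \<epsilon>) * (\<delta>\<^sup>2 - (x - z)\<^sup>2)\<^sup>2 / a x"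
  obtain \<delta> where \<delta>: "\<delta> > 0"
    and Zpos: "\<And>\<epsilon>. \<epsilon> > 0 \<Longrightarrow> integral {z - \<delta>..z + \<delta>} (?W \<delta> \<epsilon>) > 0"
    and conv: "\<And>f. f \<in> C0_torus \<Longrightarrow>
      ((\<lambda>\<epsilon>. integral {z - \<delta>..z + \<delta>} (\<lambda>x. f x * ?W \<delta> \<epsilon> x) / integral {z - \<delta>..z + \<delta>} (?W \<delta> \<epsilon>))
        \<longlongrightarrow> f z) (at_right 0)"
    and cost: "((\<lambda>\<epsilon>. \<epsilon> * integral {z - \<delta>..z + \<delta>} (\<lambda>x. exp (T x / \<epsilon>) * (2 * (x - z))\<^sup>2) /
        integral {z - \<delta>..z + \<delta>} (?W \<delta> \<epsilon>)) \<longlongrightarrow> 0) (at_right 0)"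
    using peak_estimates[OF T dh iso _ _ h'z a0 a(2,3)] gz by (auto simp: T_def)
  let ?I = "{z - \<delta>..z + \<delta>}"
  define W where "W = ?W \<delta>"
  define Z where "Z \<epsilon> = integral ?I (W \<epsilon>)" for \<epsilon>
  define J where "J \<epsilon> = integral ?I (\<lambda>x. exp (T x / \<epsilon>) * (2 * (x - z))\<^sup>2)" for \<epsilon>
  define c where "c x = \<kappa> * (a x * deriv g x)" for x
  define \<rho> where "\<rho> \<epsilon> x = indicator ?I x * W \<epsilon> x / Z \<epsilon>" for \<epsilon> x
  define r where "r \<epsilon> = \<epsilon> * J \<epsilon> / Z \<epsilon> + integral ?I (\<lambda>x. c x * W \<epsilon> x) / Z \<epsilon>" for \<epsilon>
  have Z: "Z \<epsilon> > 0" if "\<epsilon> > 0" for \<epsilon> using Zpos[OF that] by (simp add: Z_def W_def)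
  have contW: "continuous_on S (W \<epsilon>)" if "\<epsilon> > 0" for \<epsilon> S
  proof -
    have "continuous_on S T" using T by (meson DERIV_isCont continuous_at_imp_continuous_on)
    moreover have "continuous_on S a" using a0 by (auto simp: C0_torus_def intro: continuous_on_subset)
    ultimately show ?thesis
      unfolding W_def using that anz by (intro continuous_intros) auto
  qed
  have rho_integral: "integrable lborel (\<lambda>x. f x * \<rho> \<epsilon> x)"
      "(\<integral>x. f x * \<rho> \<epsilon> x \<partial>lborel) = integral ?I (\<lambda>x. f x * W \<epsilon> x) / Z \<epsilon>"
    if f: "f \<in> C0_torus" and \<epsilon>: "\<epsilon> > 0" for f \<epsilon>
  proof -
    have "continuous_on ?I (\<lambda>x. f x * W \<epsilon> x)"
      using f by (intro continuous_on_mult contW \<epsilon>) (auto simp: C0_torus_def intro: continuous_on_subset)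
    then have si: "set_integrable lborel ?I (\<lambda>x. f x * W \<epsilon> x)"
      by (rule borel_integrable_atLeastAtMost')
    have eq: "(\<lambda>x. f x * \<rho> \<epsilon> x) = (\<lambda>x. indicator ?I x *\<^sub>R (f x * W \<epsilon> x) / Z \<epsilon>)"
      by (auto simp: \<rho>_def)
    show "integrable lborel (\<lambda>x. f x * \<rho> \<epsilon> x)"
      unfolding eq using si unfolding set_integrable_def by (rule integrable_divide)
    show "(\<integral>x. f x * \<rho> \<epsilon> x \<partial>lborel) = integral ?I (\<lambda>x. f x * W \<epsilon> x) / Z \<epsilon>"
      unfolding eq using set_borel_integral_eq_integral(2)[OF si] by (simp add: set_lebesgue_integral_def)
  qed
  have cC0: "c \<in> C0_torus"
    unfolding c_def[abs_def] by (intro C0_torus_mult C0_torus_const a0 deriv_C1_torus gC1)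
  have cz: "c z = max (deriv b z) 0" by (auto simp: c_def \<kappa>_def dgz)
  have "peaked_at a b z \<rho> r"
    unfolding peaked_at_def
  proof (intro conjI allI impI ballI)
    fix \<epsilon> :: real assume \<epsilon>: "\<epsilon> > 0"
    show "\<rho> \<epsilon> x \<ge> 0" for x
      using Z[OF \<epsilon>] apos[of x] by (simp add: \<rho>_def W_def)
    show "integrable lborel (\<rho> \<epsilon>)" "(\<integral>x. \<rho> \<epsilon> x \<partial>lborel) = 1"
      using rho_integral[OF C0_torus_const[of 1] \<epsilon>] Z[OF \<epsilon>] by (simp_all add: Z_def)
    fix u assume u: "u \<in> C2_torus" "\<forall>x. u x > 0"
    have unz: "u x \<noteq> 0" for x using u(2) by (metis less_irrefl)
    have uC1: "u \<in> C1_torus" "deriv u \<in> C1_torus"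
      using u C2_torus_subset_C1_torus deriv_C2_torus by auto
    note du = C1_torus_has_derivative[OF uC1(1)] C1_torus_has_derivative[OF uC1(2)]
    let ?L = "\<lambda>x. generator a b \<epsilon> u x / u x"
    let ?U = "\<lambda>x. deriv u x / u x"
    let ?U' = "\<lambda>x. (deriv (deriv u) x * u x - deriv u x * deriv u x) / (u x * u x)"
    have cont: "continuous_on UNIV u" "continuous_on UNIV (deriv u)" "continuous_on UNIV (deriv (deriv u))"
      using uC1 C1_torus_subset_C0_torus deriv_C1_torus by (auto simp: C0_torus_def)
    have LC0: "?L \<in> C0_torus"
      unfolding generator_def using uC1 C1 a0 C1_torus_subset_C0_torus
      by (intro C0_torus_divide C0_torus_add C0_torus_mult C0_torus_const deriv_C1_torus unz) auto
    \<comment> \<open>The logarithmic derivative of \<open>u\<close> relative to the ground state \<open>exp (- \<kappa> S / \<epsilon>)\<close>,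
      where \<open>S\<close> is a primitive of \<open>g\<close>.\<close>
    let ?\<Gamma> = "\<lambda>x. ?U x + \<kappa> / \<epsilon> * g x" and ?\<Gamma>' = "\<lambda>x. ?U' x + \<kappa> / \<epsilon> * deriv g x"
    have d\<Gamma>: "(?\<Gamma> has_real_derivative ?\<Gamma>' x) (at x)" for x
      by (intro DERIV_add DERIV_divide DERIV_cmult du dg unz)
    have cont\<Gamma>: "continuous_on UNIV ?\<Gamma>'"
      using \<epsilon> unz by (intro continuous_intros cont contg) auto
    let ?q = "\<lambda>x. \<delta>\<^sup>2 - (x - z)\<^sup>2"
    have dq: "(?q has_real_derivative - (2 * (x - z))) (at x)" for x
      by (auto intro!: derivative_eq_intros)
    have "- (\<epsilon> * integral ?I (\<lambda>x. exp (T x / \<epsilon>) * (- (2 * (x - z)))\<^sup>2))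
      \<le> integral ?I (\<lambda>x. (\<tau> * g x * ?\<Gamma> x + \<epsilon> * (?\<Gamma>' x + (?\<Gamma> x)\<^sup>2)) * (exp (T x / \<epsilon>) * (?q x)\<^sup>2))"
      using \<delta> \<epsilon>
      by (intro weighted_energy_lower_bound[OF d\<Gamma> cont\<Gamma> T _ dq])
        (auto intro!: continuous_intros contg simp del: minus_mult_left)
    also have "(\<lambda>x. (\<tau> * g x * ?\<Gamma> x + \<epsilon> * (?\<Gamma>' x + (?\<Gamma> x)\<^sup>2)) * (exp (T x / \<epsilon>) * (?q x)\<^sup>2))
        = (\<lambda>x. ?L x * W \<epsilon> x + c x * W \<epsilon> x)"
    proof
      fix x
      have ba: "b x = a x * g x" using anz[of x] by (simp add: g_def)
      have U': "?U' x = deriv (deriv u) x / u x - (?U x)\<^sup>2"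
        using unz[of x] by (simp add: field_simps power2_eq_square)
      have L: "?L x = a x * (g x * ?U x + \<epsilon> * (?U' x + (?U x)\<^sup>2))"
        unfolding U' generator_def ba using unz[of x] by (simp add: field_simps)
      have change: "\<tau> * y * (v + \<kappa> / \<epsilon> * y) + \<epsilon> * (v' + \<kappa> / \<epsilon> * y' + (v + \<kappa> / \<epsilon> * y)\<^sup>2)
          = y * v + \<epsilon> * (v' + v\<^sup>2) + \<kappa> * y'" for y y' v v'
        using \<epsilon> by (auto simp: \<tau>_def \<kappa>_def field_simps power2_eq_square)
      have W: "exp (T x / \<epsilon>) * (?q x)\<^sup>2 = a x * W \<epsilon> x"
        using anz[of x] by (simp add: W_def)
      show "(\<tau> * g x * ?\<Gamma> x + \<epsilon> * (?\<Gamma>' x + (?\<Gamma> x)\<^sup>2)) * (exp (T x / \<epsilon>) * (?q x)\<^sup>2)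
          = ?L x * W \<epsilon> x + c x * W \<epsilon> x"
        unfolding change W L c_def by (simp only: distrib_left distrib_right mult_ac)
    qed
    also have "integral ?I (\<lambda>x. ?L x * W \<epsilon> x + c x * W \<epsilon> x)
        = integral ?I (\<lambda>x. ?L x * W \<epsilon> x) + integral ?I (\<lambda>x. c x * W \<epsilon> x)"
      using LC0 cC0 by (intro integral_add integrable_continuous_interval continuous_on_mult contW \<epsilon>)
        (auto simp: C0_torus_def intro: continuous_on_subset)
    finally have "- integral ?I (\<lambda>x. ?L x * W \<epsilon> x) \<le> \<epsilon> * J \<epsilon> + integral ?I (\<lambda>x. c x * W \<epsilon> x)"
      by (simp only: J_def power2_minus)
    then have "- integral ?I (\<lambda>x. ?L x * W \<epsilon> x) / Z \<epsilon> \<le> (\<epsilon> * J \<epsilon> + integral ?I (\<lambda>x. c x * W \<epsilon> x)) / Z \<epsilon>"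
      using Z[OF \<epsilon>] by (intro divide_right_mono) auto
    then show "- (\<integral>x. ?L x * \<rho> \<epsilon> x \<partial>lborel) \<le> r \<epsilon>"
      unfolding rho_integral(2)[OF LC0 \<epsilon>] r_def by (simp only: add_divide_distrib minus_divide_left)
  next
    fix f assume f: "f \<in> C0_torus"
    have "\<forall>\<^sub>F \<epsilon> in at_right 0. integral ?I (\<lambda>x. f x * W \<epsilon> x) / Z \<epsilon> = (\<integral>x. f x * \<rho> \<epsilon> x \<partial>lborel)"
      using eventually_at_right_less[of "0::real"] by eventually_elim (simp add: rho_integral(2)[OF f])
    then show "((\<lambda>\<epsilon>. \<integral>x. f x * \<rho> \<epsilon> x \<partial>lborel) \<longlongrightarrow> f z) (at_right 0)"
      using conv[OF f] unfolding W_def Z_def by (rule Lim_transform_eventually[rotated])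
  next
    have "(r \<longlongrightarrow> 0 + c z) (at_right 0)"
      unfolding r_def[abs_def] J_def Z_def W_def by (intro tendsto_add cost conv cC0)
    then show "(r \<longlongrightarrow> max (deriv b z) 0) (at_right 0)" by (simp add: cz)
  qed
  then show ?thesis by blast
qed

text \<open>
  Densities are mixed on the line and wrapped around the torus afterwards, which treats a zero at the
  seam \<open>0\<close> like every other zero.
\<close>

definition wrap_density :: "(real \<Rightarrow> real) \<Rightarrow> real measure" where
  "wrap_density \<rho> = distr (density lborel (\<lambda>x. ennreal (\<rho> x))) torus frac"

lemma frac_measurable_torus: "frac \<in> measurable borel torus"
proof -
  have "frac \<in> borel_measurable (borel :: real measure)"
    unfolding frac_def[abs_def] by measurable
  then show ?thesis
    unfolding torus_def by (intro measurable_restrict_space2) (auto simp: frac_lt_1)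
qed

lemma wrap_density_in_prob_algebra:
  assumes "\<And>x. \<rho> x \<ge> 0" "integrable lborel \<rho>" "(\<integral>x. \<rho> x \<partial>lborel) = 1"
  shows "wrap_density \<rho> \<in> space (prob_algebra torus)"
proof -
  have "prob_space (density lborel (\<lambda>x. ennreal (\<rho> x)))"
  proof (rule prob_spaceI)
    have "(\<integral>\<^sup>+x. ennreal (\<rho> x) \<partial>lborel) = ennreal (\<integral>x. \<rho> x \<partial>lborel)"
      using assms by (intro nn_integral_eq_integral) auto
    then show "emeasure (density lborel (\<lambda>x. ennreal (\<rho> x))) (space (density lborel (\<lambda>x. ennreal (\<rho> x)))) = 1"
      using assms by (simp add: emeasure_density)
  qed
  then have "prob_space (wrap_density \<rho>)"
    unfolding wrap_density_def
    by (rule prob_space.prob_space_distr) (simp add: frac_measurable_torus)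
  then show ?thesis by (simp add: space_prob_algebra wrap_density_def)
qed

lemma integral_wrap_density:
  assumes "\<And>x. \<rho> x \<ge> 0" "integrable lborel \<rho>" and f: "f \<in> C0_torus"
  shows "(\<integral>x. f x \<partial>wrap_density \<rho>) = (\<integral>x. f x * \<rho> x \<partial>lborel)"
proof -
  have "(\<integral>x. f x \<partial>wrap_density \<rho>) = (\<integral>x. f (frac x) \<partial>density lborel (\<lambda>x. ennreal (\<rho> x)))"
    unfolding wrap_density_def
    by (rule integral_distr) (simp_all add: frac_measurable_torus C0_torus_measurable f)
  also have "\<dots> = (\<integral>x. \<rho> x * f x \<partial>lborel)"
    using assms C0_torus_borel[OF f] by (simp add: C0_torus_frac integral_real_density)
  finally show ?thesis by (simp add: mult.commute)
qed

lemma C0_torus_integrable_mult: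
  assumes "f \<in> C0_torus" "integrable lborel \<rho>"
  shows "integrable lborel (\<lambda>x. f x * \<rho> x)"
proof -
  obtain B where B: "\<And>x. \<bar>f x\<bar> \<le> B" using C0_torus_bounded[OF assms(1)] by blast
  show ?thesis
  proof (rule Bochner_Integration.integrable_bound)
    show "integrable lborel (\<lambda>x. B * \<rho> x)" using assms(2) by simp
    show "(\<lambda>x. f x * \<rho> x) \<in> borel_measurable lborel"
      using C0_torus_borel[OF assms(1)] assms(2) by simp
    have "norm (f x * \<rho> x) \<le> norm (B * \<rho> x)" for x
      using B[of x] by (simp add: abs_mult mult_right_mono)
    then show "AE x in lborel. norm (f x * \<rho> x) \<le> norm (B * \<rho> x)" by simp
  qed
qed

text \<open>
  Mixing the peaked densities with the weights \<open>w\<close> suffices because the rate is a supremum of functionals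
  that are affine in the measure.
\<close>

lemma exists_recovery_family:
  assumes a: "a \<in> C1_torus" "c0 > 0" "\<And>x. a x \<ge> c0" and b: "b \<in> C2_torus"
    and nd: "\<And>z. z \<in> crit b \<Longrightarrow> deriv b z \<noteq> 0" and fin: "finite (crit b)"
    and w: "set_pmf w \<subseteq> crit b"
  obtains m where "\<And>\<epsilon>. \<epsilon> > 0 \<Longrightarrow> m \<epsilon> \<in> space (prob_algebra torus)"
    "\<And>f. f \<in> C0_torus \<Longrightarrow>
      ((\<lambda>\<epsilon>. \<integral>x. f x \<partial>m \<epsilon>) \<longlongrightarrow> (\<integral>x. f x \<partial>dirac_combination (crit b) w)) (at_right 0)"
    "Limsup (at_right 0) (\<lambda>\<epsilon>. rate a b \<epsilon> (m \<epsilon>)) \<le> ereal (\<Sum>z\<in>crit b. pmf w z * max (deriv b z) 0)"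
proof -
  have crit: "crit b \<subseteq> {0..<1}" by (auto simp: crit_def)
  have "\<forall>z\<in>crit b. \<exists>\<rho> r. peaked_at a b z \<rho> r"
    using exists_peaked_at[OF a b] nd by (auto simp: crit_def)
  then obtain \<rho> r where peak: "\<And>z. z \<in> crit b \<Longrightarrow> peaked_at a b z (\<rho> z) (r z)"
    by metis
  define \<sigma> where "\<sigma> \<epsilon> x = (\<Sum>z\<in>crit b. pmf w z * \<rho> z \<epsilon> x)" for \<epsilon> x
  define R where "R \<epsilon> = (\<Sum>z\<in>crit b. pmf w z * r z \<epsilon>)" for \<epsilon>
  have \<rho>: "\<rho> z \<epsilon> x \<ge> 0" "integrable lborel (\<rho> z \<epsilon>)" "(\<integral>x. \<rho> z \<epsilon> x \<partial>lborel) = 1"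
    if "z \<in> crit b" "\<epsilon> > 0" for z \<epsilon> x
    using peak[OF that(1)] that(2) by (auto simp: peaked_at_def)
  have \<sigma>: "\<sigma> \<epsilon> x \<ge> 0" "integrable lborel (\<sigma> \<epsilon>)" if "\<epsilon> > 0" for \<epsilon> x
    unfolding \<sigma>_def[abs_def] using \<rho> that
    by (auto intro!: sum_nonneg mult_nonneg_nonneg Bochner_Integration.integrable_sum)
  have int: "(\<integral>x. f x * \<sigma> \<epsilon> x \<partial>lborel) = (\<Sum>z\<in>crit b. pmf w z * (\<integral>x. f x * \<rho> z \<epsilon> x \<partial>lborel))"
    if f: "f \<in> C0_torus" and \<epsilon>: "\<epsilon> > 0" for f \<epsilon>
  proof -
    have "(\<integral>x. f x * \<sigma> \<epsilon> x \<partial>lborel) = (\<integral>x. (\<Sum>z\<in>crit b. pmf w z * (f x * \<rho> z \<epsilon> x)) \<partial>lborel)"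
      by (simp add: \<sigma>_def sum_distrib_left mult.left_commute)
    also have "\<dots> = (\<Sum>z\<in>crit b. \<integral>x. pmf w z * (f x * \<rho> z \<epsilon> x) \<partial>lborel)"
      using \<rho>(2) \<epsilon> f by (intro Bochner_Integration.integral_sum integrable_mult_right C0_torus_integrable_mult)
    finally show ?thesis by simp
  qed
  have sum_w: "(\<Sum>z\<in>crit b. pmf w z) = 1" using fin w by (rule sum_pmf_eq_1)
  define m where "m \<epsilon> = wrap_density (\<sigma> \<epsilon>)" for \<epsilon>
  have m: "m \<epsilon> \<in> space (prob_algebra torus)" if "\<epsilon> > 0" for \<epsilon>
    unfolding m_def
  proof (rule wrap_density_in_prob_algebra)
    show "(\<integral>x. \<sigma> \<epsilon> x \<partial>lborel) = 1"
      using int[OF C0_torus_const[of 1] that] \<rho>(3) that sum_w by simp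
  qed (use \<sigma> that in auto)
  have m_int: "(\<integral>x. f x \<partial>m \<epsilon>) = (\<Sum>z\<in>crit b. pmf w z * (\<integral>x. f x * \<rho> z \<epsilon> x \<partial>lborel))"
    if "f \<in> C0_torus" "\<epsilon> > 0" for f \<epsilon>
    unfolding m_def int[OF that, symmetric] by (intro integral_wrap_density \<sigma> that)
  show ?thesis
  proof
    show "m \<epsilon> \<in> space (prob_algebra torus)" if "\<epsilon> > 0" for \<epsilon> by (rule m[OF that])
  next
    fix f assume f: "f \<in> C0_torus"
    have "((\<lambda>\<epsilon>. \<Sum>z\<in>crit b. pmf w z * (\<integral>x. f x * \<rho> z \<epsilon> x \<partial>lborel))
        \<longlongrightarrow> (\<Sum>z\<in>crit b. pmf w z * f z)) (at_right 0)"
      using peak f by (intro tendsto_sum tendsto_mult_left) (auto simp: peaked_at_def)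
    moreover have "\<forall>\<^sub>F \<epsilon> in at_right 0. (\<Sum>z\<in>crit b. pmf w z * (\<integral>x. f x * \<rho> z \<epsilon> x \<partial>lborel)) = (\<integral>x. f x \<partial>m \<epsilon>)"
      using eventually_at_right_less[of "0::real"] by eventually_elim (simp add: m_int[OF f])
    ultimately show "((\<lambda>\<epsilon>. \<integral>x. f x \<partial>m \<epsilon>) \<longlongrightarrow> (\<integral>x. f x \<partial>dirac_combination (crit b) w)) (at_right 0)"
      unfolding integral_dirac_combination[OF fin crit w f] by (rule Lim_transform_eventually)
  next
    have le: "rate a b \<epsilon> (m \<epsilon>) \<le> ereal (R \<epsilon>)" if \<epsilon>: "\<epsilon> > 0" for \<epsilon>
      unfolding rate_def
    proof (rule SUP_least)
      fix u assume "u \<in> {u \<in> C2_torus. \<forall>x. u x > 0}"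
      then have u: "u \<in> C2_torus" "\<forall>x. u x > 0" by auto
      let ?L = "\<lambda>x. generator a b \<epsilon> u x / u x"
      have C1: "u \<in> C1_torus" "deriv u \<in> C1_torus" "b \<in> C1_torus"
        using u b C2_torus_subset_C1_torus deriv_C2_torus by auto
      have L: "?L \<in> C0_torus"
        unfolding generator_def using C1 a(1) C1_torus_subset_C0_torus u(2)
        by (intro C0_torus_divide C0_torus_add C0_torus_mult C0_torus_const deriv_C1_torus)
          (auto simp: less_imp_neq[symmetric])
      have "- (\<integral>x. ?L x \<partial>m \<epsilon>) = (\<Sum>z\<in>crit b. pmf w z * - (\<integral>x. ?L x * \<rho> z \<epsilon> x \<partial>lborel))"
        unfolding m_int[OF L \<epsilon>] by (simp add: sum_negf)
      also have "\<dots> \<le> R \<epsilon>"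
        unfolding R_def using peak u \<epsilon> by (intro sum_mono mult_left_mono) (auto simp: peaked_at_def)
      finally show "ereal (- (\<integral>x. ?L x \<partial>m \<epsilon>)) \<le> ereal (R \<epsilon>)" by simp
    qed
    have "(R \<longlongrightarrow> (\<Sum>z\<in>crit b. pmf w z * max (deriv b z) 0)) (at_right 0)"
      unfolding R_def[abs_def] using peak by (intro tendsto_sum tendsto_mult_left) (auto simp: peaked_at_def)
    then have "Limsup (at_right 0) (\<lambda>\<epsilon>. ereal (R \<epsilon>)) = ereal (\<Sum>z\<in>crit b. pmf w z * max (deriv b z) 0)"
      by (intro lim_imp_Limsup) (auto intro: tendsto_ereal)
    moreover have "Limsup (at_right 0) (\<lambda>\<epsilon>. rate a b \<epsilon> (m \<epsilon>)) \<le> Limsup (at_right 0) (\<lambda>\<epsilon>. ereal (R \<epsilon>))"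
      using eventually_at_right_less[of "0::real"] by (intro Limsup_mono) (auto elim!: eventually_mono intro: le)
    ultimately show "Limsup (at_right 0) (\<lambda>\<epsilon>. rate a b \<epsilon> (m \<epsilon>))
        \<le> ereal (\<Sum>z\<in>crit b. pmf w z * max (deriv b z) 0)" by simp
  qed
qed

section \<open>The zero level set and the Gamma-limit\<close>

text \<open>
  All terms of the sum in \<open>J0\<close> are nonnegative, and by nondegeneracy a term with positive weight
  vanishes exactly at the stable zeros.
\<close>

lemma J0_zero_level_set:
  assumes fin: "finite (crit b)" and nd: "\<And>z. z \<in> crit b \<Longrightarrow> deriv b z \<noteq> 0"
  shows "{\<mu> \<in> space (prob_algebra torus). J0 b \<mu> = 0}
    = {dirac_combination (stable_crit b) w | w. set_pmf w \<subseteq> stable_crit b}" (is "?L = ?R")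
proof -
  have crit: "crit b \<subseteq> {0..<1}" by (auto simp: crit_def)
  have sub: "stable_crit b \<subseteq> crit b" by (auto simp: stable_crit_def)
  note fin' = finite_subset[OF sub fin] and crit' = order_trans[OF sub crit]
  have same: "dirac_combination (stable_crit b) w = dirac_combination (crit b) w"
    if "set_pmf w \<subseteq> stable_crit b" for w
    using that sub
    by (simp add: dirac_combination_eq_distr[OF fin' crit'] dirac_combination_eq_distr[OF fin crit])
  have zero_iff: "J0 b (dirac_combination (crit b) w) = 0 \<longleftrightarrow> set_pmf w \<subseteq> stable_crit b"
    if w: "set_pmf w \<subseteq> crit b" for w
  proof -
    have "(\<Sum>z\<in>crit b. pmf w z * max (deriv b z) 0) = 0
        \<longleftrightarrow> (\<forall>z\<in>crit b. pmf w z * max (deriv b z) 0 = 0)"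
      using fin by (intro sum_nonneg_eq_0_iff) auto
    also have "\<dots> \<longleftrightarrow> (\<forall>z\<in>crit b. z \<in> set_pmf w \<longrightarrow> deriv b z < 0)"
    proof (intro ball_cong refl)
      fix z assume "z \<in> crit b"
      then show "pmf w z * max (deriv b z) 0 = 0 \<longleftrightarrow> (z \<in> set_pmf w \<longrightarrow> deriv b z < 0)"
        using nd[of z] by (auto simp: set_pmf_iff max_def)
    qed
    also have "\<dots> \<longleftrightarrow> set_pmf w \<subseteq> stable_crit b"
      using w by (auto simp: stable_crit_def)
    finally show ?thesis by (simp add: J0_dirac_combination[OF fin w] zero_ereal_def)
  qed
  show ?thesis
  proof (intro equalityI subsetI)
    fix \<mu> assume \<mu>: "\<mu> \<in> ?L"
    then obtain w where w: "set_pmf w \<subseteq> crit b" "\<mu> = dirac_combination (crit b) w"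
      by (auto simp: J0_def split: if_splits)
    with \<mu> zero_iff[OF w(1)] have stable: "set_pmf w \<subseteq> stable_crit b" by simp
    show "\<mu> \<in> ?R"
      using stable by (intro CollectI exI[of _ w]) (simp add: same[OF stable] w(2))
  next
    fix \<mu> assume "\<mu> \<in> ?R"
    then obtain w where w: "set_pmf w \<subseteq> stable_crit b" "\<mu> = dirac_combination (stable_crit b) w"
      by auto
    then have "set_pmf w \<subseteq> crit b" using sub by auto
    with w zero_iff[of w] same[of w] dirac_combination_in_prob_algebra[OF fin' crit' w(1)]
    show "\<mu> \<in> ?L" by simp
  qed
qed

theorem proposition2p3:
  fixes a b :: "real \<Rightarrow> real" and c0 :: real and N :: nat
  assumes "a \<in> C2_torus" and "b \<in> C2_torus"
    and "c0 > 0" and "\<And>x. a x \<ge> c0"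
    and "N \<ge> 1" and "finite (crit b)" and "card (crit b) = 2 * N"
    and "\<And>z. z \<in> crit b \<Longrightarrow> deriv b z \<noteq> 0"
    and "(LINT x:{0..<1}|lborel. b x / a x) \<ge> 0"
  shows "gamma_converges weak_topology (rate a b) (J0 b)
    \<and> {\<mu> \<in> space (prob_algebra torus). J0 b \<mu> = 0}
      = {dirac_combination (stable_crit b) w | w. set_pmf w \<subseteq> stable_crit b}"
proof
  note fin = assms(6) and nd = assms(8)
  have aC1: "a \<in> C1_torus" and bC1: "b \<in> C1_torus"
    using assms(1,2) C2_torus_subset_C1_torus by auto
  then have C0: "a \<in> C0_torus" "b \<in> C0_torus" "deriv b \<in> C0_torus"
    using C1_torus_subset_C0_torus deriv_C1_torus by auto
  have frac_crit: "frac x \<in> crit b" if "b x = 0" for x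
    using that C0_torus_frac[OF C0(2)] by (simp add: crit_def frac_lt_1)
  have nd': "deriv b x \<noteq> 0" if "b x = 0" for x
    using nd[OF frac_crit[OF that]] C0_torus_frac[OF C0(3)] by simp
  have crit: "crit b \<subseteq> {0..<1}" by (auto simp: crit_def)
  obtain z where z: "b z = 0" "deriv b z \<noteq> 0"
  proof -
    have "crit b \<noteq> {}" using assms(5,7) by auto
    then show ?thesis using that nd by (auto simp: crit_def)
  qed
  show "gamma_converges weak_topology (rate a b) (J0 b)"
    unfolding gamma_converges_def topspace_weak_topology
  proof (intro ballI conjI allI impI)
    fix \<mu> and m :: "real \<Rightarrow> real measure"
    assume \<mu>: "\<mu> \<in> space (prob_algebra torus)"
      and m: "(\<forall>\<epsilon>>0. m \<epsilon> \<in> space (prob_algebra torus)) \<and> limitin weak_topology m \<mu> (at_right 0)"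
    have "\<forall>\<^sub>F \<epsilon> in at_right 0. m \<epsilon> \<in> space (prob_algebra torus)"
      using eventually_at_right_less[of "0::real"] by (rule eventually_mono) (use m in auto)
    then have lim: "((\<lambda>\<epsilon>. \<integral>x. f x \<partial>m \<epsilon>) \<longlongrightarrow> (\<integral>x. f x \<partial>\<mu>)) (at_right 0)"
      if "f \<in> C0_torus" for f
      using m that limitin_weak_topology by blast
    show "J0 b \<mu> \<le> Liminf (at_right 0) (\<lambda>\<epsilon>. rate a b \<epsilon> (m \<epsilon>))"
    proof (cases "AE x in \<mu>. b x = 0")
      case True
      then have "AE x in \<mu>. x \<in> crit b"
        using AE_space by eventually_elim (auto simp: crit_def prob_torus_facts(3)[OF \<mu>])
      then obtain w where w: "set_pmf w \<subseteq> crit b" "\<mu> = dirac_combination (crit b) w"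
        using concentrated_imp_dirac_combination[OF fin crit \<mu>] by blast
      show ?thesis
        unfolding w(2) J0_dirac_combination[OF fin w(1)]
        using m lim[unfolded w(2)]
        by (intro Liminf_rate_ge_dirac[OF aC1 assms(3,4,2) nd' fin w(1)]) auto
    next
      case False
      have "Liminf (at_right 0) (\<lambda>\<epsilon>. rate a b \<epsilon> (m \<epsilon>)) = \<infinity>"
        using m by (intro Liminf_rate_infinite[OF C0(1) bC1 z \<mu> _ lim False]) auto
      then show ?thesis by simp
    qed
  next
    fix \<mu> assume \<mu>: "\<mu> \<in> space (prob_algebra torus)"
    show "\<exists>m. (\<forall>\<epsilon>>0. m \<epsilon> \<in> space (prob_algebra torus)) \<and> limitin weak_topology m \<mu> (at_right 0)
      \<and> Limsup (at_right 0) (\<lambda>\<epsilon>. rate a b \<epsilon> (m \<epsilon>)) \<le> J0 b \<mu>"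
    proof (cases "\<exists>w. set_pmf w \<subseteq> crit b \<and> \<mu> = dirac_combination (crit b) w")
      case True
      then obtain w where w: "set_pmf w \<subseteq> crit b" "\<mu> = dirac_combination (crit b) w" by blast
      obtain m where m: "\<And>\<epsilon>. \<epsilon> > 0 \<Longrightarrow> m \<epsilon> \<in> space (prob_algebra torus)"
        and lim: "\<And>f. f \<in> C0_torus \<Longrightarrow>
          ((\<lambda>\<epsilon>. \<integral>x. f x \<partial>m \<epsilon>) \<longlongrightarrow> (\<integral>x. f x \<partial>dirac_combination (crit b) w)) (at_right 0)"
        and sup: "Limsup (at_right 0) (\<lambda>\<epsilon>. rate a b \<epsilon> (m \<epsilon>))
          \<le> ereal (\<Sum>z\<in>crit b. pmf w z * max (deriv b z) 0)"
        using exists_recovery_family[OF aC1 assms(3,4,2) nd fin w(1)] by blast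
      have "\<forall>\<^sub>F \<epsilon> in at_right 0. m \<epsilon> \<in> space (prob_algebra torus)"
        using eventually_at_right_less[of "0::real"] by (rule eventually_mono) (rule m)
      then have "limitin weak_topology m \<mu> (at_right 0)"
        using \<mu> lim by (subst limitin_weak_topology) (simp_all add: w(2))
      then show ?thesis
        using m sup by (intro exI[of _ m]) (simp add: w(2) J0_dirac_combination[OF fin w(1)])
    next
      case False
      then have "J0 b \<mu> = \<infinity>" unfolding J0_def by simp
      then show ?thesis
        using \<mu> by (intro exI[of _ "\<lambda>_. \<mu>"]) simp
    qed
  qed
  show "{\<mu> \<in> space (prob_algebra torus). J0 b \<mu> = 0}
      = {dirac_combination (stable_crit b) w | w. set_pmf w \<subseteq> stable_crit b}"
    by (rule J0_zero_level_set[OF fin nd])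
qed

end
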